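(* For every $n\in\mathbb{N}$ (i.e. $n\ge1$), the generating function of the renormalized values satisfies, in $\mathbb{C}[[t_1,\dots,t_n]]$, $$Z_{\mathrm{EMS}}(t_1,\dots,t_n)=\prod_{i=1}^n\frac{(t_i+\cdots+t_n)-(e^{t_i+\cdots+t_n}-1)}{(t_i+\cdots+t_n)(e^{t_i+\cdots+t_n}-1)},$$ where $\frac{u-(e^u-1)}{u(e^u-1)}$ is understood as a power series in $u$. Equivalently, for all $k_1,\dots,k_n\in\mathbb{N}_0$, $$\zeta_{\mathrm{EMS}}(-k_1,\dots,-k_n)=(-1)^{k_1+\cdots+k_n}\sum_{\substack{\nu_{1i}+\cdots+\nu_{ii}=k_i\\1\leq i\leq n}}\ \prod_{i=1}^n\frac{k_i!}{\prod_{j=i}^n\nu_{ij}!}\,\frac{B_{\nu_{ii}+\cdots+\nu_{in}+1}}{\nu_{ii}+\cdots+\nu_{in}+1},$$ where the sum runs over all families of non-negative integers $(\nu_{ij})_{1\le i\le j\le n}$ with $\nu_{1i}+\nu_{2i}+\cdots+\nu_{ii}=k_i$ for each $1\le i\le n$, and $B_m$ are the Bernoulli numbers.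
   Context: $\mathbb{N}=\{1,2,\dots\}$, $\mathbb{N}_0=\{0,1,2,\dots\}$. Bernoulli numbers: $\frac{x}{e^x-1}=\sum_{m\ge0}\frac{B_m}{m!}x^m$ (so $B_1=-\frac12$). **Generating function.** $$Z_{\mathrm{EMS}}(t_1,\dots,t_n):=\sum_{k_1,\dots,k_n=0}^{\infty}\frac{(-t_1)^{k_1}\cdots(-t_n)^{k_n}}{k_1!\cdots k_n!}\,\zeta_{\mathrm{EMS}}(-k_1,\dots,-k_n)\in\mathbb{C}[[t_1,\dots,t_n]].$$ **Renormalized values.** Let $L=\{d,y\}$, let $L^*$ be the free monoid on $L$ with unit the empty word $\mathbf{1}$, and $\mathbb{Q}\langle L\rangle$ the $\mathbb{Q}$-span of $L^*$. Put $Y:=L^*y\cup\{\mathbf{1}\}$. Define a $\mathbb{Q}$-bilinear product $\sqcup\!\sqcup_0$ on $\mathbb{Q}\langle L\rangle$ recursively, for words $u,v,w\in L^*$, by $\mathbf 1\sqcup\!\sqcup_0 w=w\sqcup\!\sqcup_0\mathbf 1=w$; $\ yu\sqcup\!\sqcup_0 v=u\sqcup\!\sqcup_0 yv=y(u\sqcup\!\sqcup_0 v)$; $\ du\sqcup\!\sqcup_0 dv=d(u\sqcup\!\sqcup_0 dv)-u\sqcup\!\sqcup_0 d^2v$. Let $\mathcal{T}_-$ be the linear span of $\{wd\mid w\in L^*\}$; let $\mathcal{L}_-$ be the two-sided ideal of $(\mathbb{Q}\langle L\rangle,\sqcup\!\sqcup_0)$ generated by all $d^k\{d(u\sqcup\!\sqcup_0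 v)-du\sqcup\!\sqcup_0 v-u\sqcup\!\sqcup_0 dv\}$ with $k\in\mathbb{N}_0$, $u,v\in L^*$; put $\mathcal{S}_-:=\mathcal{T}_-+\mathcal{L}_-$ (a two-sided ideal) and $\mathcal{H}_0:=\mathbb{Q}\langle L\rangle/\mathcal{S}_-$. It is known (Ebrahimi-Fard–Manchon–Singer) that $\mathcal{H}_0$ is a connected filtered commutative and cocommutative Hopf algebra with product $\sqcup\!\sqcup_0$ and coproduct given, for $w=x_1\cdots x_N\in Y\setminus\{\mathbf 1\}$ ($x_i\in L$), by $\Delta_0(w)=\sum_{S}w_S\otimes w_{\overline S}$, the sum being over all $S\subset\{1,\dots,N\}$ (possibly empty) such that $w_S,w_{\overline S}\in Y$, where $\overline S$ is the complement of $S$ and $w_S:=x_{i_1}\cdots x_{i_r}$ for $S=\{i_1<\cdots<i_r\}$. The counit $\varepsilon$ satisfies $\varepsilon(\mathbf 1)=1$ and $\varepsilon(w)=0$ for $w\in Y\setminus\{\mathbf 1\}$. Let $\mathcal{A}:=\mathbb{Q}[[z]][\frac1z]=\mathcal{A}_-\oplus\mathcal{A}_+$ with $\mathcal{A}_-=\frac1z\mathbb{Q}[\frac1z]$, $\mathcal{A}_+=\mathbb{Q}[[z]]$. For linear maps $\alpha,\beta:\mathcal{H}_0\to\mathcal{A}$ the convolution is $\alpha*\beta:=m_{\mathcal{A}}\circ(\alpha\otimes\beta)\circ\Delta_0$; the linear maps with $\mathbf 1\mapsto1$ form a group under $*$. Let $\phi:\mathcal{H}_0\to\mathcal{A}$ be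 the linear map with $\phi(\mathbf 1)=1$ and $\phi(d^{k_1}y\cdots d^{k_n}y)(z)=\partial_z^{k_1}(x\partial_z^{k_2})\cdots(x\partial_z^{k_n})(x)$, $x=x(z)=\frac{e^z}{1-e^z}$ (known to be a well-defined algebra homomorphism). By the algebraic Birkhoff decomposition there are unique linear maps $\phi_+:\mathcal{H}_0\to\mathcal{A}_+$ and $\phi_-:\mathcal{H}_0\to\mathbb{Q}\oplus\mathcal{A}_-$ with $\phi_-(\mathbf 1)=1$, $\phi_-(\ker\varepsilon)\subset\mathcal{A}_-$ and $\phi=\phi_-^{-1}*\phi_+$ (inverse with respect to $*$); both are algebra homomorphisms. The renormalized value is $$\zeta_{\mathrm{EMS}}(-k_1,\dots,-k_n):=\lim_{z\to0}\phi_+(d^{k_n}y\cdots d^{k_1}y)(z)\qquad(k_1,\dots,k_n\in\mathbb{N}_0).$$ *)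

theory Defs
  imports
    Complex_Main
    "HOL-Library.FuncSet"
    "HOL-Library.Poly_Mapping"
    "HOL-Computational_Algebra.Formal_Laurent_Series"
begin

section \<open>Free rational vector spaces\<close>

definition qscale :: "rat \<Rightarrow> ('a \<Rightarrow>\<^sub>0 rat) \<Rightarrow> ('a \<Rightarrow>\<^sub>0 rat)" where
  "qscale c a = Poly_Mapping.map ((*) c) a"

lemma lookup_qscale [simp]: "Poly_Mapping.lookup (qscale c a) w = c * Poly_Mapping.lookup a w"
  by (simp add: qscale_def Poly_Mapping.map.rep_eq when_def)

interpretation free: vector_space "qscale :: rat \<Rightarrow> ('a \<Rightarrow>\<^sub>0 rat) \<Rightarrow> ('a \<Rightarrow>\<^sub>0 rat)"
  by unfold_locales (auto intro!: poly_mapping_eqI simp: lookup_add algebra_simps)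

abbreviation bas :: "'a \<Rightarrow> ('a \<Rightarrow>\<^sub>0 rat)" where
  "bas w \<equiv> Poly_Mapping.single w 1"

text \<open>Linear extension of a map on basis elements, \<open>s\<close> being the scaling of the codomain.\<close>

definition lin_ext :: "(rat \<Rightarrow> 'b \<Rightarrow> 'b) \<Rightarrow> ('a \<Rightarrow> 'b) \<Rightarrow> ('a \<Rightarrow>\<^sub>0 rat) \<Rightarrow> 'b::ab_group_add" where
  "lin_ext s f a = (\<Sum>w\<in>Poly_Mapping.keys a. s (Poly_Mapping.lookup a w) (f w))"

lemma lin_ext_linear:
  assumes "vector_space s"
  shows "Vector_Spaces.linear qscale s (lin_ext s f)"
proof -
  interpret vector_space s by fact
  have ext: "lin_ext s f a = (\<Sum>w\<in>A. s (Poly_Mapping.lookup a w) (f w))"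
    if "finite A" "Poly_Mapping.keys a \<subseteq> A" for a A
    unfolding lin_ext_def using that
    by (intro sum.mono_neutral_left) (auto simp: in_keys_iff)
  show ?thesis
  proof unfold_locales
    fix a b :: "'b \<Rightarrow>\<^sub>0 rat"
    let ?A = "Poly_Mapping.keys a \<union> Poly_Mapping.keys b"
    have "Poly_Mapping.keys (a + b) \<subseteq> ?A" by (rule Poly_Mapping.keys_add)
    then show "lin_ext s f (a + b) = lin_ext s f a + lin_ext s f b"
      by (simp add: ext[of ?A] lookup_add scale_left_distrib sum.distrib)
  next
    fix c and a :: "'b \<Rightarrow>\<^sub>0 rat"
    have "Poly_Mapping.keys (qscale c a) \<subseteq> Poly_Mapping.keys a"
      by (auto simp: in_keys_iff)
    then show "lin_ext s f (qscale c a) = s c (lin_ext s f a)"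
      by (simp add: ext[of "Poly_Mapping.keys a"] scale_sum_right)
  qed
qed

lemma lin_ext_bas: "vector_space s \<Longrightarrow> lin_ext s f (bas w) = f w"
  by (simp add: lin_ext_def vector_space.vector_space_assms)

lemma bas_in_subspace:
  assumes "free.subspace V" "\<And>w. bas w \<in> V"
  shows "a \<in> V"
proof -
  have "a = (\<Sum>w\<in>Poly_Mapping.keys a. qscale (Poly_Mapping.lookup a w) (bas w))"
    by (rule poly_mapping_eqI)
      (auto simp: lookup_sum lookup_single when_def in_keys_iff if_distrib cong: if_cong)
  also have "\<dots> \<in> V"
    by (intro free.subspace_sum free.subspace_scale assms)
  finally show ?thesis .
qed

lemma linear_eq_on_bas:
  assumes "Vector_Spaces.linear qscale s f" "Vector_Spaces.linear qscale s g"
    and "\<And>w. f (bas w) = g (bas w)"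
  shows "f a = g a"
proof -
  interpret f: Vector_Spaces.linear qscale s f by fact
  interpret g: Vector_Spaces.linear qscale s g by fact
  have "a \<in> {a. f a = g a}"
    by (rule bas_in_subspace)
      (auto simp: free.subspace_def f.zero g.zero f.add g.add f.scale g.scale assms(3))
  then show ?thesis by simp
qed


section \<open>The algebra of words and its product\<close>

datatype letter = Ld | Ly

type_synonym lword = "letter list"

definition Yset :: "lword set" where
  "Yset = {w @ [Ly] | w. True} \<union> {[]}"

text \<open>Left concatenation with a letter, extended linearly.\<close>

definition pre :: "letter \<Rightarrow> (lword \<Rightarrow>\<^sub>0 rat) \<Rightarrow> (lword \<Rightarrow>\<^sub>0 rat)" where
  "pre x = lin_ext qscale (\<lambda>w. bas (x # w))"

function shw :: "lword \<Rightarrow> lword \<Rightarrow> (lword \<Rightarrow>\<^sub>0 rat)" where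
  "shw [] v = bas v"
| "shw (Ly # u) v = pre Ly (shw u v)"
| "shw (Ld # u) [] = bas (Ld # u)"
| "shw (Ld # u) (Ly # v) = pre Ly (shw (Ld # u) v)"
| "shw (Ld # u) (Ld # v) = pre Ld (shw u (Ld # v)) - shw u (Ld # Ld # v)"
  by pat_completeness auto
termination
  by (relation "measures [\<lambda>(u, v). length u, \<lambda>(u, v). length v]") auto

definition sh :: "(lword \<Rightarrow>\<^sub>0 rat) \<Rightarrow> (lword \<Rightarrow>\<^sub>0 rat) \<Rightarrow> (lword \<Rightarrow>\<^sub>0 rat)" where
  "sh a b = lin_ext qscale (\<lambda>u. lin_ext qscale (\<lambda>v. shw u v) b) a"

lemma pre_linear: "Vector_Spaces.linear qscale qscale (pre x)"
  unfolding pre_def by (rule lin_ext_linear) (rule free.vector_space_axioms)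

interpretation pre: Vector_Spaces.linear qscale qscale "pre x"
  by (rule pre_linear)

lemma pre_bas [simp]: "pre x (bas w) = bas (x # w)"
  unfolding pre_def by (rule lin_ext_bas) (rule free.vector_space_axioms)

text \<open>The clauses of \<^const>\<open>shw\<close> are disjoint; the remaining instances of the recursive
  description of the product follow.\<close>

lemma shw_Nil_right [simp]: "shw u [] = bas u"
proof (induction u)
  case (Cons x u) then show ?case by (cases x) auto
qed auto

lemma shw_Ly_right: "shw u (Ly # v) = pre Ly (shw u v)"
proof (induction u)
  case (Cons x u) then show ?case by (cases x) auto
qed auto

lemma sh_bas [simp]: "sh (bas u) (bas v) = shw u v"
  unfolding sh_def by (simp add: lin_ext_bas free.vector_space_axioms)

lemma sh_linear_left: "Vector_Spaces.linear qscale qscale (\<lambda>a. sh a b)"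
  unfolding sh_def by (rule lin_ext_linear) (rule free.vector_space_axioms)

interpretation shl: Vector_Spaces.linear qscale qscale "\<lambda>a. sh a b"
  by (rule sh_linear_left)

lemma sh_linear_right: "Vector_Spaces.linear qscale qscale (\<lambda>b. sh a b)"
proof -
  interpret l: Vector_Spaces.linear qscale qscale "lin_ext qscale (\<lambda>v. shw u v)" for u
    by (rule lin_ext_linear) (rule free.vector_space_axioms)
  show ?thesis
  proof unfold_locales
    fix b1 b2
    show "sh a (b1 + b2) = sh a b1 + sh a b2"
      unfolding sh_def l.add
      by (simp add: lin_ext_def free.scale_right_distrib sum.distrib)
  next
    fix c b
    show "sh a (qscale c b) = qscale c (sh a b)"
      unfolding sh_def l.scale
      by (simp add: lin_ext_def free.scale_sum_right mult.left_commute mult.commute)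
  qed
qed

interpretation shr: Vector_Spaces.linear qscale qscale "\<lambda>b. sh a b"
  by (rule sh_linear_right)


section \<open>The ideal and the quotient\<close>

definition two_sided_ideal :: "(lword \<Rightarrow>\<^sub>0 rat) set \<Rightarrow> bool" where
  "two_sided_ideal I \<longleftrightarrow> free.subspace I \<and> (\<forall>a. \<forall>b\<in>I. sh a b \<in> I \<and> sh b a \<in> I)"

definition T_minus :: "(lword \<Rightarrow>\<^sub>0 rat) set" where
  "T_minus = free.span {bas (w @ [Ld]) | w. True}"

definition leibniz_defect :: "(lword \<Rightarrow>\<^sub>0 rat) \<Rightarrow> (lword \<Rightarrow>\<^sub>0 rat) \<Rightarrow> (lword \<Rightarrow>\<^sub>0 rat)" where
  "leibniz_defect a b = pre Ld (sh a b) - sh (pre Ld a) b - sh a (pre Ld b)"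

definition L_minus :: "(lword \<Rightarrow>\<^sub>0 rat) set" where
  "L_minus = two_sided_ideal hull
     {(pre Ld ^^ k) (leibniz_defect (bas u) (bas v)) | k u v. True}"

definition S_minus :: "(lword \<Rightarrow>\<^sub>0 rat) set" where
  "S_minus = {a + b | a b. a \<in> T_minus \<and> b \<in> L_minus}"

lemma L_minus_ideal: "two_sided_ideal L_minus"
  unfolding L_minus_def
proof (rule hull_in)
  fix \<F> assume "Ball \<F> two_sided_ideal"
  then show "two_sided_ideal (\<Inter>\<F>)"
    by (auto simp: two_sided_ideal_def intro!: free.subspace_Inter)
qed

lemma subspace_T_minus: "free.subspace T_minus"
  unfolding T_minus_def by (rule free.subspace_span)

lemma subspace_L_minus: "free.subspace L_minus"
  using L_minus_ideal by (simp add: two_sided_ideal_def)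

lemma subspace_S_minus: "free.subspace S_minus"
  unfolding S_minus_def by (rule free.subspace_sums[OF subspace_T_minus subspace_L_minus])

lemma T_minus_subset: "T_minus \<subseteq> S_minus"
  unfolding S_minus_def using free.subspace_0[OF subspace_L_minus] by force

lemma L_minus_subset: "L_minus \<subseteq> S_minus"
  unfolding S_minus_def using free.subspace_0[OF subspace_T_minus] by force

lemma L_minus_gen: "(pre Ld ^^ k) (leibniz_defect (bas u) (bas v)) \<in> L_minus"
  unfolding L_minus_def by (rule hull_inc) blast

lemma L_minus_least:
  assumes "two_sided_ideal I"
    and "\<And>k u v. (pre Ld ^^ k) (leibniz_defect (bas u) (bas v)) \<in> I"
  shows "L_minus \<subseteq> I"
  unfolding L_minus_def using assms by (intro hull_minimal) auto

quotient_type h0 = "lword \<Rightarrow>\<^sub>0 rat" / "\<lambda>a b. a - b \<in> S_minus"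
  morphisms rep_h0 cls
proof (rule equivpI)
  show "reflp (\<lambda>a b. a - b \<in> S_minus)"
    by (rule reflpI) (simp add: free.subspace_0[OF subspace_S_minus])
  show "symp (\<lambda>a b. a - b \<in> S_minus)"
    using free.subspace_neg[OF subspace_S_minus] by (intro sympI) force
  show "transp (\<lambda>a b. a - b \<in> S_minus)"
    using free.subspace_add[OF subspace_S_minus] by (intro transpI) force
qed

instantiation h0 :: ab_group_add
begin

lift_definition zero_h0 :: h0 is 0 .

lift_definition plus_h0 :: "h0 \<Rightarrow> h0 \<Rightarrow> h0" is "(+)"
  subgoal for a a' b b'
    using free.subspace_add[OF subspace_S_minus, of "a - a'" "b - b'"]
    by (simp add: algebra_simps)
  done

lift_definition minus_h0 :: "h0 \<Rightarrow> h0 \<Rightarrow> h0" is "(-)"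
  subgoal for a a' b b'
    using free.subspace_diff[OF subspace_S_minus, of "a - a'" "b - b'"]
    by (simp add: algebra_simps)
  done

lift_definition uminus_h0 :: "h0 \<Rightarrow> h0" is uminus
  subgoal for a a'
    using free.subspace_neg[OF subspace_S_minus, of "a - a'"]
    by (simp add: algebra_simps)
  done

instance
  by standard (transfer; simp add: free.subspace_0[OF subspace_S_minus] algebra_simps)+

end

lift_definition hscale :: "rat \<Rightarrow> h0 \<Rightarrow> h0" is qscale
  subgoal for c a a'
    using free.subspace_scale[OF subspace_S_minus, of "a - a'" c]
    by (simp add: free.scale_right_diff_distrib)
  done

interpretation h0: vector_space hscale
  by unfold_locales (transfer; simp add: free.subspace_0[OF subspace_S_minus] free.scale_right_distrib
      free.scale_left_distrib)+

abbreviation wcls :: "lword \<Rightarrow> h0" where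
  "wcls w \<equiv> cls (bas w)"

lemma cls_eq_0_iff: "cls a = 0 \<longleftrightarrow> a \<in> S_minus"
  using h0.abs_eq_iff[of a 0] by (simp add: zero_h0_def)

lemma cls_linear: "Vector_Spaces.linear qscale hscale cls"
  by unfold_locales (simp_all add: plus_h0.abs_eq hscale.abs_eq)

section \<open>The target algebra and the character\<close>

definition fscale :: "rat \<Rightarrow> rat fls \<Rightarrow> rat fls" where
  "fscale c f = fls_const c * f"

interpretation fls: vector_space fscale
  by unfold_locales (auto simp: fscale_def algebra_simps fls_plus_const[symmetric] fls_const_mult_const)

definition A_plus :: "rat fls set" where
  "A_plus = range fps_to_fls"

definition A_minus :: "rat fls set" where
  "A_minus = {f. \<forall>n\<ge>0. fls_nth f n = 0}"

definition xz :: "rat fls" where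
  "xz = fps_to_fls (fps_exp 1) / (1 - fps_to_fls (fps_exp 1))"

text \<open>Laurent series over the rationals are the algebra \<open>\<rat>[[z]][1/z]\<close>.
  On words ending in \<^const>\<open>Ld\<close> this yields \<open>0\<close>, because the innermost derivative is applied
  to \<open>1\<close>.\<close>

primrec phi_word :: "lword \<Rightarrow> rat fls" where
  "phi_word [] = 1"
| "phi_word (l # w) = (case l of Ld \<Rightarrow> fls_deriv (phi_word w) | Ly \<Rightarrow> xz * phi_word w)"

lemma two_sided_ideal_ker:
  assumes "Vector_Spaces.linear qscale s f"
    and "\<And>a b. f b = 0 \<Longrightarrow> f (sh a b) = 0 \<and> f (sh b a) = 0"
  shows "two_sided_ideal {a. f a = 0}"
proof -
  interpret f: Vector_Spaces.linear qscale s f by fact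
  show ?thesis
    unfolding two_sided_ideal_def using assms(2) f.subspace_kernel by auto
qed

lemma S_minus_ker:
  assumes lin: "Vector_Spaces.linear qscale s f"
    and "\<And>w. f (bas (w @ [Ld])) = 0"
    and "\<And>a b. f b = 0 \<Longrightarrow> f (sh a b) = 0 \<and> f (sh b a) = 0"
    and "\<And>k u v. f ((pre Ld ^^ k) (leibniz_defect (bas u) (bas v))) = 0"
    and "a \<in> S_minus"
  shows "f a = 0"
proof -
  interpret f: Vector_Spaces.linear qscale s f by fact
  have "T_minus \<subseteq> {a. f a = 0}"
    unfolding T_minus_def by (rule free.span_minimal) (use assms(2) f.subspace_kernel in auto)
  moreover have "L_minus \<subseteq> {a. f a = 0}"
    by (rule L_minus_least) (use assms(4) two_sided_ideal_ker[OF lin assms(3)] in auto)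
  ultimately show ?thesis
    using assms(5) by (auto simp: S_minus_def f.add subset_iff)
qed

lemma linear_sh_mult:
  fixes f :: "(lword \<Rightarrow>\<^sub>0 rat) \<Rightarrow> 'b::comm_ring_1"
  assumes "Vector_Spaces.linear qscale s f"
    and s: "\<And>c x y. s c x * y = s c (x * y)"
    and shw: "\<And>u v. f (shw u v) = f (bas u) * f (bas v)"
  shows "f (sh a b) = f a * f b"
proof -
  interpret f: Vector_Spaces.linear qscale s f by fact
  have s': "x * s c y = s c (x * y)" for c x y
    using s[of c y x] by (simp add: mult.commute)
  have *: "b \<in> {b. f (sh (bas u) b) = f (bas u) * f b}" for u
    by (rule bas_in_subspace)
      (auto simp: free.subspace_def shr.zero shr.add shr.scale f.zero f.add f.scale shw s'
        distrib_left)
  have "a \<in> {a. f (sh a b) = f a * f b}"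
    by (rule bas_in_subspace)
      (use * in \<open>auto simp: free.subspace_def shl.zero shl.add shl.scale f.zero f.add f.scale s
        distrib_right\<close>)
  then show ?thesis by simp
qed

abbreviation phi_free :: "(lword \<Rightarrow>\<^sub>0 rat) \<Rightarrow> rat fls" where
  "phi_free \<equiv> lin_ext fscale phi_word"

lemma phi_free_linear: "Vector_Spaces.linear qscale fscale phi_free"
  by (rule lin_ext_linear) (rule fls.vector_space_axioms)

interpretation phi_free: Vector_Spaces.linear qscale fscale phi_free
  by (rule phi_free_linear)

lemma phi_free_bas [simp]: "phi_free (bas w) = phi_word w"
  by (rule lin_ext_bas) (rule fls.vector_space_axioms)

lemma fls_deriv_linear: "Vector_Spaces.linear fscale fscale fls_deriv"
  by unfold_locales (auto simp: fscale_def)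

lemma fls_mult_linear: "Vector_Spaces.linear fscale fscale ((*) f)"
  by unfold_locales (auto simp: fscale_def algebra_simps)

lemma phi_free_pre:
  "phi_free (pre Ld a) = fls_deriv (phi_free a)"
  "phi_free (pre Ly a) = xz * phi_free a"
proof -
  show "phi_free (pre Ld a) = fls_deriv (phi_free a)"
    using linear_eq_on_bas[OF Vector_Spaces.linear_compose[OF pre_linear phi_free_linear]
        Vector_Spaces.linear_compose[OF phi_free_linear fls_deriv_linear]] by simp
  show "phi_free (pre Ly a) = xz * phi_free a"
    using linear_eq_on_bas[OF Vector_Spaces.linear_compose[OF pre_linear phi_free_linear]
        Vector_Spaces.linear_compose[OF phi_free_linear fls_mult_linear]] by simp
qed

lemma phi_free_shw: "phi_free (shw u v) = phi_word u * phi_word v"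
  by (induction u v rule: shw.induct)
    (simp_all add: phi_free_pre phi_free.diff algebra_simps)

lemma phi_free_sh: "phi_free (sh a b) = phi_free a * phi_free b"
  by (rule linear_sh_mult[OF phi_free_linear]) (simp_all add: phi_free_shw fscale_def)

lemma phi_free_S_minus:
  assumes "a \<in> S_minus"
  shows "phi_free a = 0"
proof (rule S_minus_ker[OF phi_free_linear _ _ _ assms])
  fix w show "phi_free (bas (w @ [Ld])) = 0"
  proof (induction w)
    case (Cons x w) then show ?case by (cases x) auto
  qed simp
next
  fix k u v
  have "phi_free ((pre Ld ^^ k) a) = (fls_deriv ^^ k) (phi_free a)" for a
    by (induction k) (auto simp: phi_free_pre)
  moreover have "phi_free (leibniz_defect (bas u) (bas v)) = 0"
    by (simp add: leibniz_defect_def phi_free.diff phi_free_pre phi_free_sh phi_free_shw)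
  moreover have "(fls_deriv ^^ k) (0 :: rat fls) = 0"
    by (induction k) auto
  ultimately show "phi_free ((pre Ld ^^ k) (leibniz_defect (bas u) (bas v))) = 0"
    by simp
qed (simp add: phi_free_sh)

lift_definition phi :: "h0 \<Rightarrow> rat fls" is phi_free
  using phi_free_S_minus by (fastforce simp: phi_free.diff)


section \<open>Counit, coproduct and convolution\<close>

lemma lookup_linear: "Vector_Spaces.linear qscale (*) (\<lambda>a. Poly_Mapping.lookup a w)"
  by unfold_locales (auto simp: lookup_add algebra_simps)

lemma lookup_pre_Nil [simp]: "Poly_Mapping.lookup (pre x a) [] = 0"
  by (simp add: pre_def lin_ext_def lookup_sum lookup_single)

lemma lookup_shw_Nil:
  "Poly_Mapping.lookup (shw u v) [] = Poly_Mapping.lookup (bas u) [] * Poly_Mapping.lookup (bas v) []"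
  by (induction u v rule: shw.induct) (simp_all add: lookup_single lookup_minus)

lemma lookup_sh_Nil:
  "Poly_Mapping.lookup (sh a b) [] = Poly_Mapping.lookup a [] * Poly_Mapping.lookup b []"
  by (rule linear_sh_mult[OF lookup_linear]) (simp_all add: lookup_shw_Nil)

lemma lookup_S_minus_Nil:
  assumes "a \<in> S_minus"
  shows "Poly_Mapping.lookup a [] = 0"
proof (rule S_minus_ker[OF lookup_linear _ _ _ assms])
  fix k u v
  show "Poly_Mapping.lookup ((pre Ld ^^ k) (leibniz_defect (bas u) (bas v))) [] = 0"
    by (cases k) (simp_all add: leibniz_defect_def lookup_minus lookup_shw_Nil lookup_single)
qed (simp_all add: lookup_sh_Nil lookup_single)

lift_definition counit :: "h0 \<Rightarrow> rat" is "\<lambda>a. Poly_Mapping.lookup a []"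
  using lookup_S_minus_Nil by (fastforce simp: lookup_minus)

text \<open>The tensor square of the free space on words is the free space on pairs of words.
  For a word ending in \<^const>\<open>Ld\<close> the sum is empty, which is consistent with such words
  being zero in the quotient.\<close>

definition coprod_word :: "lword \<Rightarrow> (lword \<times> lword) \<Rightarrow>\<^sub>0 rat" where
  "coprod_word w =
     (\<Sum>S\<in>{S. S \<subseteq> {..<length w} \<and> nths w S \<in> Yset \<and> nths w ({..<length w} - S) \<in> Yset}.
        bas (nths w S, nths w ({..<length w} - S)))"

definition coprod :: "(lword \<Rightarrow>\<^sub>0 rat) \<Rightarrow> (lword \<times> lword) \<Rightarrow>\<^sub>0 rat" where
  "coprod = lin_ext qscale coprod_word"

definition pairing :: "(h0 \<Rightarrow> rat fls) \<Rightarrow> (h0 \<Rightarrow> rat fls) \<Rightarrow> ((lword \<times> lword) \<Rightarrow>\<^sub>0 rat) \<Rightarrow> rat fls" where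
  "pairing \<alpha> \<beta> = lin_ext fscale (\<lambda>(u, v). \<alpha> (wcls u) * \<beta> (wcls v))"

text \<open>The convolution is computed on a representative; lemma \<open>conv_cls\<close> below shows that the
  choice does not matter, i.e. that the coproduct descends to the quotient.\<close>

definition conv :: "(h0 \<Rightarrow> rat fls) \<Rightarrow> (h0 \<Rightarrow> rat fls) \<Rightarrow> h0 \<Rightarrow> rat fls" where
  "conv \<alpha> \<beta> h = pairing \<alpha> \<beta> (coprod (rep_h0 h))"

abbreviation hlinear :: "(h0 \<Rightarrow> rat fls) \<Rightarrow> bool" where
  "hlinear \<equiv> Vector_Spaces.linear hscale fscale"

text \<open>Splitting a word into two complementary subwords, in all possible ways.\<close>

fun splits :: "(lword \<Rightarrow> lword \<Rightarrow> 'b) \<Rightarrow> lword \<Rightarrow> 'b::comm_monoid_add" where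
  "splits B [] = B [] []"
| "splits B (x # w) = splits (\<lambda>a b. B (x # a) b) w + splits (\<lambda>a b. B a (x # b)) w"

lemma splits_sum:
  "splits B w = (\<Sum>S\<in>Pow {..<length w}. B (nths w S) (nths w ({..<length w} - S)))"
proof (induction w arbitrary: B)
  case (Cons x w)
  let ?n = "length w"
  have Pow: "Pow {..<Suc ?n} = (\<lambda>S. insert 0 (Suc ` S)) ` Pow {..<?n} \<union> (\<lambda>S. Suc ` S) ` Pow {..<?n}"
  proof -
    have "{..<Suc ?n} = insert 0 (Suc ` {..<?n})" by (rule lessThan_Suc_eq_insert_0)
    then have "Pow {..<Suc ?n} = Pow (Suc ` {..<?n}) \<union> insert 0 ` Pow (Suc ` {..<?n})"
      by (simp only: Pow_insert)
    also have "Pow (Suc ` {..<?n}) = (\<lambda>S. Suc ` S) ` Pow {..<?n}"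
      by (metis image_Pow_surj)
    finally show ?thesis by (auto simp: image_image)
  qed
  have disj: "(\<lambda>S. insert 0 (Suc ` S)) ` Pow {..<?n} \<inter> (\<lambda>S. Suc ` S) ` Pow {..<?n} = {}"
    by auto
  have inj1: "inj_on (\<lambda>S. insert 0 (Suc ` S)) (Pow {..<?n})"
  proof (rule inj_onI)
    fix A B assume "insert 0 (Suc ` A) = insert 0 (Suc ` B)"
    then have "insert 0 (Suc ` A) - {0} = insert 0 (Suc ` B) - {0}" by simp
    moreover have "insert 0 (Suc ` C) - {0} = Suc ` C" for C by auto
    ultimately have "Suc ` A = Suc ` B" by simp
    then show "A = B" by (simp add: inj_image_eq_iff)
  qed
  have inj2: "inj_on (\<lambda>S. Suc ` S) (Pow {..<?n})"
    by (simp add: inj_on_def inj_image_eq_iff)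
  have "splits B (x # w) =
      (\<Sum>S\<in>Pow {..<?n}. B (x # nths w S) (nths w ({..<?n} - S))) +
      (\<Sum>S\<in>Pow {..<?n}. B (nths w S) (x # nths w ({..<?n} - S)))"
    by (simp add: Cons.IH)
  also have "\<dots> = (\<Sum>S\<in>(\<lambda>S. insert 0 (Suc ` S)) ` Pow {..<?n} \<union> (\<lambda>S. Suc ` S) ` Pow {..<?n}.
      B (nths (x # w) S) (nths (x # w) ({..<Suc ?n} - S)))"
    by (subst sum.union_disjoint[OF _ _ disj], simp, simp,
        subst sum.reindex[OF inj1], subst sum.reindex[OF inj2])
      (auto simp: nths_Cons image_iff o_def intro!: arg_cong2[where f = "(+)"] sum.cong
        arg_cong2[where f = B] arg_cong[where f = "nths w"])
  also have "\<dots> = (\<Sum>S\<in>Pow {..<length (x # w)}. 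
      B (nths (x # w) S) (nths (x # w) ({..<length (x # w)} - S)))"
    by (simp only: Pow list.size add_0_right add_Suc_right)
  finally show ?case .
qed auto

lemma splits_add: "splits (\<lambda>a b. B a b + C a b) w = splits B w + splits C w"
  by (simp add: splits_sum sum.distrib)

lemma splits_diff:
  "splits (\<lambda>a b. B a b - C a b :: 'b::ab_group_add) w = splits B w - splits C w"
  by (simp add: splits_sum sum_subtractf)

lemma splits_zero: "(\<And>a b. B a b = 0) \<Longrightarrow> splits B w = 0"
  by (simp add: splits_sum)

lemma linear_minus:
  assumes "Vector_Spaces.linear s1 s2 f" "Vector_Spaces.linear s1 s2 g"
  shows "Vector_Spaces.linear s1 s2 (\<lambda>x. f x - g x)"
proof -
  interpret f: Vector_Spaces.linear s1 s2 f by fact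
  interpret g: Vector_Spaces.linear s1 s2 g by fact
  show ?thesis
    by unfold_locales (simp_all add: f.add g.add f.scale g.scale f.vs2.scale_right_diff_distrib)
qed

lemma leibniz_defect_linear:
  "Vector_Spaces.linear qscale qscale (\<lambda>a. leibniz_defect a b)"
  "Vector_Spaces.linear qscale qscale (\<lambda>b. leibniz_defect a b)"
  unfolding leibniz_defect_def
  by (rule linear_minus[OF linear_minus[OF
        Vector_Spaces.linear_compose[OF sh_linear_left pre_linear, unfolded o_def]
        Vector_Spaces.linear_compose[OF pre_linear sh_linear_left, unfolded o_def]]
        sh_linear_left])
    (rule linear_minus[OF linear_minus[OF
        Vector_Spaces.linear_compose[OF sh_linear_right pre_linear, unfolded o_def]
        sh_linear_right]
        Vector_Spaces.linear_compose[OF pre_linear sh_linear_right, unfolded o_def]])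

lemma linear_subspace_vimage:
  assumes "Vector_Spaces.linear qscale qscale f" "free.subspace V"
  shows "free.subspace (f -` V)"
proof -
  interpret f: Vector_Spaces.linear qscale qscale f by fact
  show ?thesis using assms(2) by (rule f.subspace_vimage)
qed

lemma leibniz_defect_L_minus: "leibniz_defect a b \<in> L_minus"
proof -
  have *: "leibniz_defect (bas u) (bas v) \<in> L_minus" for u v
    using L_minus_gen[of 0] by (simp del: pre_bas)
  have **: "b \<in> leibniz_defect (bas u) -` L_minus" for u
    by (rule bas_in_subspace[OF linear_subspace_vimage[OF leibniz_defect_linear(2) subspace_L_minus]])
      (simp add: * del: pre_bas)
  have "a \<in> (\<lambda>a. leibniz_defect a b) -` L_minus"
    by (rule bas_in_subspace[OF linear_subspace_vimage[OF leibniz_defect_linear(1) subspace_L_minus]])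
      (use ** in simp)
  then show ?thesis by (rule vimageD)
qed

lemma pre_Ly_eq: "pre Ly a = sh (bas [Ly]) a"
  by (rule linear_eq_on_bas[OF pre_linear sh_linear_right]) simp

lemma pre_L_minus:
  assumes "a \<in> L_minus"
  shows "pre x a \<in> L_minus"
proof (cases x)
  case Ly
  then show ?thesis using assms L_minus_ideal by (simp add: two_sided_ideal_def pre_Ly_eq)
next
  case Ld
  note add = free.subspace_add[OF subspace_L_minus]
  have ideal: "sh a b \<in> L_minus" "sh b a \<in> L_minus" if "b \<in> L_minus" for a b
    using that L_minus_ideal by (auto simp: two_sided_ideal_def)
  have "pre Ld (sh a b) = leibniz_defect a b + sh (pre Ld a) b + sh a (pre Ld b)" for a b
    by (simp add: leibniz_defect_def)
  then have "pre Ld (sh a b) \<in> L_minus" "pre Ld (sh b a) \<in> L_minus"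
    if "b \<in> L_minus" "pre Ld b \<in> L_minus" for a b
    by (simp_all only: ideal that add leibniz_defect_L_minus)
  moreover have "(pre Ld ^^ Suc k) (leibniz_defect (bas u) (bas v)) \<in> L_minus" for k u v
    by (rule L_minus_gen)
  ultimately have "L_minus \<subseteq> L_minus \<inter> pre Ld -` L_minus"
    by (intro L_minus_least)
      (auto simp: two_sided_ideal_def ideal L_minus_gen intro!: free.subspace_inter subspace_L_minus pre.subspace_vimage)
  then show ?thesis using assms Ld by auto
qed

lemma pre_T_minus:
  assumes "a \<in> T_minus"
  shows "pre x a \<in> T_minus"
proof -
  have "bas (x # w @ [Ld]) \<in> T_minus" for w
    unfolding T_minus_def by (rule free.span_base) (rule CollectI, rule exI[of _ "x # w"], simp)
  moreover have "free.subspace (pre x -` T_minus)"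
    by (rule pre.subspace_vimage) (rule subspace_T_minus)
  ultimately have "free.span {bas (w @ [Ld]) | w. True} \<subseteq> pre x -` T_minus"
    by (intro free.span_minimal) auto
  then have "T_minus \<subseteq> pre x -` T_minus"
    by (simp only: T_minus_def[symmetric])
  then show ?thesis using assms by auto
qed

lemma S_minus_induct:
  assumes "free.subspace V" "T_minus \<subseteq> V" "L_minus \<subseteq> V"
  shows "S_minus \<subseteq> V"
  unfolding S_minus_def using assms by (auto intro!: free.subspace_add)

lemma pre_S_minus:
  assumes "a \<in> S_minus"
  shows "pre x a \<in> S_minus"
proof -
  have "T_minus \<subseteq> pre x -` S_minus" "L_minus \<subseteq> pre x -` S_minus"
    using T_minus_subset L_minus_subset pre_T_minus pre_L_minus by blast+
  then have "S_minus \<subseteq> pre x -` S_minus"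
    by (intro S_minus_induct pre.subspace_vimage subspace_S_minus)
  then show ?thesis using assms by auto
qed

lemma bas_snoc_S_minus: "bas (w @ [Ld]) \<in> S_minus"
  by (rule subsetD[OF T_minus_subset]) (auto simp: T_minus_def intro!: free.span_base)

lemma shw_S_minus:
  "shw (w @ [Ld]) v \<in> S_minus"
  "shw v (w @ [Ld]) \<in> S_minus"
proof -
  have *: "(\<exists>w. u = w @ [Ld]) \<or> (\<exists>w. v = w @ [Ld]) \<Longrightarrow> shw u v \<in> S_minus" for u v
  proof (induction u v rule: shw.induct)
    case (5 u v)
    have "\<exists>w. Ld # v = w @ [Ld] \<Longrightarrow> \<exists>w. Ld # Ld # v = w @ [Ld]"
      by (metis append_Cons)
    with 5 show ?case
      by (cases "u = []")
        (auto simp: Cons_eq_append_conv free.subspace_0[OF subspace_S_minus] intro!: free.subspace_diff[OF subspace_S_minus] pre_S_minus)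
  qed (auto simp: Cons_eq_append_conv shw_Ly_right bas_snoc_S_minus intro!: pre_S_minus
        bas_snoc_S_minus bas_snoc_S_minus[of "[]", simplified] bas_snoc_S_minus[of "_ # _", simplified])
  show "shw (w @ [Ld]) v \<in> S_minus" "shw v (w @ [Ld]) \<in> S_minus"
    by (rule *; blast)+
qed

lemma S_minus_ideal:
  assumes "b \<in> S_minus"
  shows "sh a b \<in> S_minus" "sh b a \<in> S_minus"
proof -
  have sub: "free.subspace ((\<lambda>a. sh a (bas (w @ [Ld]))) -` S_minus \<inter> sh (bas (w @ [Ld])) -` S_minus)" for w
    by (intro free.subspace_inter shl.subspace_vimage shr.subspace_vimage subspace_S_minus)
  have "a \<in> (\<lambda>a. sh a (bas (w @ [Ld]))) -` S_minus \<inter> sh (bas (w @ [Ld])) -` S_minus" for w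
    by (rule bas_in_subspace[OF sub]) (simp add: shw_S_minus)
  then have "T_minus \<subseteq> sh a -` S_minus \<inter> (\<lambda>b. sh b a) -` S_minus"
    unfolding T_minus_def
    by (intro free.span_minimal free.subspace_inter shl.subspace_vimage shr.subspace_vimage
        subspace_S_minus) auto
  moreover have "L_minus \<subseteq> sh a -` S_minus \<inter> (\<lambda>b. sh b a) -` S_minus"
    using L_minus_ideal L_minus_subset by (auto simp: two_sided_ideal_def)
  ultimately have "S_minus \<subseteq> sh a -` S_minus \<inter> (\<lambda>b. sh b a) -` S_minus"
    by (intro S_minus_induct free.subspace_inter shl.subspace_vimage shr.subspace_vimage
        subspace_S_minus)
  then show "sh a b \<in> S_minus" "sh b a \<in> S_minus"
    using assms by auto
qed


definition vanishing :: "((lword \<Rightarrow>\<^sub>0 rat) \<Rightarrow> rat fls) \<Rightarrow> bool" where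
  "vanishing \<alpha> \<longleftrightarrow> Vector_Spaces.linear qscale fscale \<alpha> \<and> (\<forall>a\<in>S_minus. \<alpha> a = 0)"

definition conv_free ::
  "((lword \<Rightarrow>\<^sub>0 rat) \<Rightarrow> rat fls) \<Rightarrow> ((lword \<Rightarrow>\<^sub>0 rat) \<Rightarrow> rat fls) \<Rightarrow> (lword \<Rightarrow>\<^sub>0 rat) \<Rightarrow> rat fls" where
  "conv_free \<alpha> \<beta> = lin_ext fscale (splits (\<lambda>u v. \<alpha> (bas u) * \<beta> (bas v)))"

lemma conv_free_linear: "Vector_Spaces.linear qscale fscale (conv_free \<alpha> \<beta>)"
  unfolding conv_free_def by (rule lin_ext_linear) (rule fls.vector_space_axioms)

lemma conv_free_bas [simp]: "conv_free \<alpha> \<beta> (bas w) = splits (\<lambda>u v. \<alpha> (bas u) * \<beta> (bas v)) w"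
  unfolding conv_free_def by (rule lin_ext_bas) (rule fls.vector_space_axioms)

lemma vanishing_pre: "vanishing \<alpha> \<Longrightarrow> vanishing (\<lambda>a. \<alpha> (pre x a))"
  using Vector_Spaces.linear_compose[OF pre_linear[of x], of fscale \<alpha>]
  by (auto simp: vanishing_def o_def pre_S_minus)

lemma vanishing_sh:
  assumes "vanishing \<alpha>"
  shows "vanishing (\<lambda>a. \<alpha> (sh b a))" "vanishing (\<lambda>a. \<alpha> (sh a b))"
  using Vector_Spaces.linear_compose[OF sh_linear_right[of b], of fscale \<alpha>]
    Vector_Spaces.linear_compose[OF sh_linear_left[of b], of fscale \<alpha>] assms
  by (auto simp: vanishing_def o_def S_minus_ideal)

lemma linear_plus:
  assumes "Vector_Spaces.linear s1 s2 f" "Vector_Spaces.linear s1 s2 g"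
  shows "Vector_Spaces.linear s1 s2 (\<lambda>x. f x + g x)"
proof -
  interpret f: Vector_Spaces.linear s1 s2 f by fact
  interpret g: Vector_Spaces.linear s1 s2 g by fact
  show ?thesis
    by unfold_locales (simp_all add: f.add g.add f.scale g.scale f.vs2.scale_right_distrib)
qed

lemma conv_free_pre:
  "conv_free \<alpha> \<beta> (pre x a) = conv_free (\<lambda>a. \<alpha> (pre x a)) \<beta> a + conv_free \<alpha> (\<lambda>a. \<beta> (pre x a)) a"
proof -
  have "Vector_Spaces.linear qscale fscale (\<lambda>a. conv_free \<alpha> \<beta> (pre x a))"
    using Vector_Spaces.linear_compose[OF pre_linear conv_free_linear] by (simp add: o_def)
  moreover have "Vector_Spaces.linear qscale fscale
      (\<lambda>a. conv_free (\<lambda>a. \<alpha> (pre x a)) \<beta> a + conv_free \<alpha> (\<lambda>a. \<beta> (pre x a)) a)"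
    by (intro linear_plus conv_free_linear)
  ultimately show ?thesis
    by (rule linear_eq_on_bas) simp
qed

lemma vanishing_leibniz:
  assumes "vanishing \<alpha>"
  shows "\<alpha> (pre Ld (shw u v)) = \<alpha> (shw (Ld # u) v) + \<alpha> (shw u (Ld # v))"
proof -
  interpret Vector_Spaces.linear qscale fscale \<alpha> using assms by (simp add: vanishing_def)
  have "\<alpha> (leibniz_defect (bas u) (bas v)) = 0"
    using assms leibniz_defect_L_minus L_minus_subset by (auto simp: vanishing_def)
  then have "\<alpha> (pre Ld (shw u v)) - \<alpha> (shw (Ld # u) v) - \<alpha> (shw u (Ld # v)) = 0"
    by (simp add: leibniz_defect_def diff)
  then show ?thesis by (simp add: algebra_simps)
qed

text \<open>Multiplicativity of the coproduct modulo the ideal.\<close>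

lemma conv_free_shw:
  assumes "vanishing \<alpha>" "vanishing \<beta>"
  shows "conv_free \<alpha> \<beta> (shw u v) =
    splits (\<lambda>u' u''. splits (\<lambda>v' v''. \<alpha> (shw u' v') * \<beta> (shw u'' v'')) v) u"
  using assms
proof (induction u v arbitrary: \<alpha> \<beta> rule: shw.induct)
  case (2 u v)
  then show ?case by (simp add: conv_free_pre vanishing_pre)
next
  case (3 u)
  then show ?case by simp
next
  case (4 u v)
  then show ?case by (simp add: conv_free_pre vanishing_pre shw_Ly_right splits_add)
next
  case (5 u v)
  interpret F: Vector_Spaces.linear qscale fscale "conv_free \<alpha> \<beta>" by (rule conv_free_linear)
  note L = vanishing_leibniz[OF 5(3)] vanishing_leibniz[OF 5(4)]
  have "conv_free \<alpha> \<beta> (shw (Ld # u) (Ld # v)) =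
      conv_free (\<lambda>a. \<alpha> (pre Ld a)) \<beta> (shw u (Ld # v)) + conv_free \<alpha> (\<lambda>a. \<beta> (pre Ld a)) (shw u (Ld # v))
      - conv_free \<alpha> \<beta> (shw u (Ld # Ld # v))"
    by (simp add: F.diff conv_free_pre)
  also have "\<dots> = splits (\<lambda>u' u''. splits (\<lambda>v' v''. \<alpha> (pre Ld (shw u' v')) * \<beta> (shw u'' v'')) (Ld # v)) u
      + splits (\<lambda>u' u''. splits (\<lambda>v' v''. \<alpha> (shw u' v') * \<beta> (pre Ld (shw u'' v''))) (Ld # v)) u
      - splits (\<lambda>u' u''. splits (\<lambda>v' v''. \<alpha> (shw u' v') * \<beta> (shw u'' v'')) (Ld # Ld # v)) u"
    by (simp only: 5 vanishing_pre)
  also have "\<dots> = splits (\<lambda>u' u''. splits (\<lambda>v' v''. \<alpha> (shw u' v') * \<beta> (shw u'' v'')) (Ld # v)) (Ld # u)"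
    by (simp add: L algebra_simps flip: splits_add splits_diff)
  finally show ?case .
qed simp

lemma splits_linear:
  assumes "\<And>b c. Vector_Spaces.linear qscale fscale (\<lambda>a. B a b c)"
  shows "Vector_Spaces.linear qscale fscale (\<lambda>a. splits (B a) w)"
  using assms
proof (induction w arbitrary: B)
  case (Cons x w)
  then show ?case by (auto intro!: linear_plus)
qed simp

lemma conv_free_sh:
  assumes "vanishing \<alpha>" "vanishing \<beta>"
  shows "conv_free \<alpha> \<beta> (sh (bas u) b) =
      splits (\<lambda>u' u''. conv_free (\<lambda>a. \<alpha> (sh (bas u') a)) (\<lambda>a. \<beta> (sh (bas u'') a)) b) u"
    "conv_free \<alpha> \<beta> (sh b (bas u)) =
      splits (\<lambda>u' u''. conv_free (\<lambda>a. \<alpha> (sh a (bas u'))) (\<lambda>a. \<beta> (sh a (bas u''))) b) u"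
proof -
  have comm: "splits (\<lambda>a b. splits (\<lambda>c d. B a b c d) v) u = splits (\<lambda>c d. splits (\<lambda>a b. B a b c d) u) v"
    for B :: "_ \<Rightarrow> _ \<Rightarrow> _ \<Rightarrow> _ \<Rightarrow> rat fls" and u v
    unfolding splits_sum by (rule sum.swap)
  have "Vector_Spaces.linear qscale fscale (\<lambda>b. conv_free \<alpha> \<beta> (sh (bas u) b))"
    using Vector_Spaces.linear_compose[OF sh_linear_right conv_free_linear] by (simp add: o_def)
  then show "conv_free \<alpha> \<beta> (sh (bas u) b) =
      splits (\<lambda>u' u''. conv_free (\<lambda>a. \<alpha> (sh (bas u') a)) (\<lambda>a. \<beta> (sh (bas u'') a)) b) u"
    by (rule linear_eq_on_bas)
      (use assms in \<open>auto intro!: splits_linear conv_free_linear simp: conv_free_shw\<close>)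
  have "Vector_Spaces.linear qscale fscale (\<lambda>b. conv_free \<alpha> \<beta> (sh b (bas u)))"
    using Vector_Spaces.linear_compose[OF sh_linear_left conv_free_linear] by (simp add: o_def)
  then show "conv_free \<alpha> \<beta> (sh b (bas u)) =
      splits (\<lambda>u' u''. conv_free (\<lambda>a. \<alpha> (sh a (bas u'))) (\<lambda>a. \<beta> (sh a (bas u''))) b) u"
    by (rule linear_eq_on_bas)
      (use assms in \<open>auto intro!: splits_linear conv_free_linear simp: conv_free_shw comm[of _ u]\<close>)
qed

text \<open>The coproduct maps the ideal into the kernel of the projection onto the tensor square
  of the quotient.\<close>

lemma conv_free_S_minus:
  assumes "vanishing \<alpha>" "vanishing \<beta>" "a \<in> S_minus"
  shows "conv_free \<alpha> \<beta> a = 0"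
proof -
  define K where "K = {a. \<forall>\<alpha> \<beta>. vanishing \<alpha> \<longrightarrow> vanishing \<beta> \<longrightarrow> conv_free \<alpha> \<beta> a = 0}"
  have subK: "free.subspace K"
  proof -
    have "free.subspace {a. conv_free \<alpha> \<beta> a = 0}" for \<alpha> \<beta>
    proof -
      interpret F: Vector_Spaces.linear qscale fscale "conv_free \<alpha> \<beta>" by (rule conv_free_linear)
      show ?thesis by (rule F.subspace_kernel)
    qed
    then show ?thesis unfolding K_def free.subspace_def by blast
  qed
  have preK: "pre x a \<in> K" if "a \<in> K" for x a
    using that by (auto simp: K_def conv_free_pre vanishing_pre)
  have "bas (w @ [Ld]) \<in> K" for w
  proof (induction w)
    case Nil
    have *: "\<gamma> (bas [Ld]) = 0" if "vanishing \<gamma>" for \<gamma>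
      using that bas_snoc_S_minus[of "[]"] by (auto simp: vanishing_def)
    show ?case by (simp add: K_def *)
  next
    case (Cons x w)
    then show ?case using preK[of "bas (w @ [Ld])" x] by simp
  qed
  then have "T_minus \<subseteq> K"
    unfolding T_minus_def by (intro free.span_minimal subK) auto
  moreover have "L_minus \<subseteq> K"
  proof (rule L_minus_least)
    have shK: "sh (bas u) b \<in> K" "sh b (bas u) \<in> K" if "b \<in> K" for u b
      using that by (auto simp: K_def conv_free_sh vanishing_sh intro!: splits_zero)
    have "sh a b \<in> K" "sh b a \<in> K" if "b \<in> K" for a b
    proof -
      have "a \<in> (\<lambda>a. sh a b) -` K"
        by (rule bas_in_subspace) (auto intro!: shl.subspace_vimage subK shK that)
      then show "sh a b \<in> K" by simp
      have "a \<in> sh b -` K"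
        by (rule bas_in_subspace) (auto intro!: shr.subspace_vimage subK shK that)
      then show "sh b a \<in> K" by simp
    qed
    then show "two_sided_ideal K" by (simp add: two_sided_ideal_def subK)
  next
    fix k u v
    have "leibniz_defect (bas u) (bas v) \<in> K"
    proof -
      have "conv_free \<alpha> \<beta> (leibniz_defect (bas u) (bas v)) = 0"
        if v: "vanishing \<alpha>" "vanishing \<beta>" for \<alpha> \<beta>
      proof -
        interpret F: Vector_Spaces.linear qscale fscale "conv_free \<alpha> \<beta>" by (rule conv_free_linear)
        note L = vanishing_leibniz[OF v(1)] vanishing_leibniz[OF v(2)]
        have "conv_free \<alpha> \<beta> (leibniz_defect (bas u) (bas v)) =
          splits (\<lambda>u' u''. splits (\<lambda>v' v''. \<alpha> (pre Ld (shw u' v')) * \<beta> (shw u'' v'')) v) u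
          + splits (\<lambda>u' u''. splits (\<lambda>v' v''. \<alpha> (shw u' v') * \<beta> (pre Ld (shw u'' v''))) v) u
          - splits (\<lambda>u' u''. splits (\<lambda>v' v''. \<alpha> (shw u' v') * \<beta> (shw u'' v'')) v) (Ld # u)
          - splits (\<lambda>u' u''. splits (\<lambda>v' v''. \<alpha> (shw u' v') * \<beta> (shw u'' v'')) (Ld # v)) u"
          by (simp only: leibniz_defect_def F.diff sh_bas pre_bas conv_free_pre
              conv_free_shw v vanishing_pre)
        also have "\<dots> = 0"
          by (simp add: L algebra_simps flip: splits_add)
        finally show ?thesis .
      qed
      then show ?thesis by (simp add: K_def)
    qed
    then show "(pre Ld ^^ k) (leibniz_defect (bas u) (bas v)) \<in> K"
      by (induction k) (auto simp: preK)
  qed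
  ultimately have "S_minus \<subseteq> K"
    by (intro S_minus_induct subK)
  then show ?thesis using assms by (auto simp: K_def)
qed

lemma vanishing_not_Yset:
  assumes "vanishing \<alpha>" "w \<notin> Yset"
  shows "\<alpha> (bas w) = 0"
proof (cases w rule: rev_cases)
  case (snoc v x)
  with assms have "w = v @ [Ld]" by (cases x) (auto simp: Yset_def)
  then show ?thesis using assms bas_snoc_S_minus by (auto simp: vanishing_def)
qed (use assms in \<open>auto simp: Yset_def\<close>)

lemma hlinear_vanishing:
  assumes "hlinear \<alpha>"
  shows "vanishing (\<lambda>a. \<alpha> (cls a))"
proof -
  interpret Vector_Spaces.linear hscale fscale \<alpha> by fact
  show ?thesis
    using Vector_Spaces.linear_compose[OF cls_linear assms]
    by (auto simp: vanishing_def o_def zero cls_eq_0_iff[THEN iffD2])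
qed

lemma pairing_bas [simp]: "pairing \<alpha> \<beta> (bas (u, v)) = \<alpha> (wcls u) * \<beta> (wcls v)"
  by (simp add: pairing_def lin_ext_bas fls.vector_space_axioms)

lemma pairing_coprod:
  assumes "hlinear \<alpha>" "hlinear \<beta>"
  shows "pairing \<alpha> \<beta> (coprod a) = conv_free (\<lambda>a. \<alpha> (cls a)) (\<lambda>a. \<beta> (cls a)) a"
proof (rule linear_eq_on_bas[OF _ conv_free_linear])
  have P: "Vector_Spaces.linear qscale fscale (pairing \<alpha> \<beta>)"
    unfolding pairing_def by (rule lin_ext_linear) (rule fls.vector_space_axioms)
  have C: "Vector_Spaces.linear qscale qscale coprod"
    unfolding coprod_def by (rule lin_ext_linear) (rule free.vector_space_axioms)
  show "Vector_Spaces.linear qscale fscale (\<lambda>a. pairing \<alpha> \<beta> (coprod a))"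
    using Vector_Spaces.linear_compose[OF C P] by (simp add: o_def)
  fix w :: lword
  interpret P: Vector_Spaces.linear qscale fscale "pairing \<alpha> \<beta>" by (rule P)
  let ?n = "{..<length w}"
  have "pairing \<alpha> \<beta> (coprod (bas w)) =
      (\<Sum>S | S \<subseteq> ?n \<and> nths w S \<in> Yset \<and> nths w (?n - S) \<in> Yset.
        \<alpha> (wcls (nths w S)) * \<beta> (wcls (nths w (?n - S))))"
    by (simp add: coprod_def lin_ext_bas free.vector_space_axioms coprod_word_def P.sum)
  also have "\<dots> = (\<Sum>S\<in>Pow ?n. \<alpha> (wcls (nths w S)) * \<beta> (wcls (nths w (?n - S))))"
    using vanishing_not_Yset[OF hlinear_vanishing[OF assms(1)]]
      vanishing_not_Yset[OF hlinear_vanishing[OF assms(2)]]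
    by (intro sum.mono_neutral_left) auto
  finally show "pairing \<alpha> \<beta> (coprod (bas w)) = conv_free (\<lambda>a. \<alpha> (cls a)) (\<lambda>a. \<beta> (cls a)) (bas w)"
    by (simp add: splits_sum)
qed

lemma conv_cls:
  assumes "hlinear \<alpha>" "hlinear \<beta>"
  shows "conv \<alpha> \<beta> (cls a) = pairing \<alpha> \<beta> (coprod a)"
proof -
  interpret F: Vector_Spaces.linear qscale fscale "conv_free (\<lambda>a. \<alpha> (cls a)) (\<lambda>a. \<beta> (cls a))"
    by (rule conv_free_linear)
  have "cls (rep_h0 (cls a)) = cls a" by (rule Quotient3_abs_rep[OF Quotient3_h0])
  then have "rep_h0 (cls a) - a \<in> S_minus" by (simp add: h0.abs_eq_iff)
  from conv_free_S_minus[OF hlinear_vanishing[OF assms(1)] hlinear_vanishing[OF assms(2)] this]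
  show ?thesis by (simp add: conv_def pairing_coprod assms F.diff)
qed


section \<open>Birkhoff decomposition and renormalized values\<close>

definition conv_unit :: "h0 \<Rightarrow> rat fls" where
  "conv_unit h = fls_const (counit h)"

definition conv_inverse :: "(h0 \<Rightarrow> rat fls) \<Rightarrow> (h0 \<Rightarrow> rat fls) \<Rightarrow> bool" where
  "conv_inverse \<alpha> \<psi> \<longleftrightarrow> hlinear \<psi> \<and> \<psi> (wcls []) = 1 \<and>
     conv \<psi> \<alpha> = conv_unit \<and> conv \<alpha> \<psi> = conv_unit"

definition birkhoff :: "(h0 \<Rightarrow> rat fls) \<Rightarrow> (h0 \<Rightarrow> rat fls) \<Rightarrow> bool" where
  "birkhoff \<phi>m \<phi>p \<longleftrightarrow>
     hlinear \<phi>m \<and> hlinear \<phi>p \<and>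
     range \<phi>p \<subseteq> A_plus \<and>
     range \<phi>m \<subseteq> {fls_const c + f | c f. f \<in> A_minus} \<and>
     \<phi>m (wcls []) = 1 \<and>
     \<phi>m ` {h. counit h = 0} \<subseteq> A_minus \<and>
     (\<exists>\<psi>. conv_inverse \<phi>m \<psi> \<and> phi = conv \<psi> \<phi>p)"

text \<open>The Birkhoff decomposition exists and is unique.\<close>

definition phi_plus :: "h0 \<Rightarrow> rat fls" where
  "phi_plus = (THE \<phi>p. \<exists>\<phi>m. birkhoff \<phi>m \<phi>p)"

text \<open>For the list \<open>[k\<^sub>1, \<dots>, k\<^sub>n]\<close> this is the renormalized value at
  \<open>(-k\<^sub>1, \<dots>, -k\<^sub>n)\<close>; the limit at \<open>z = 0\<close> of a power series is its
  constant coefficient. Note the reversal of the arguments in the word.\<close>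

definition zeta_EMS :: "nat list \<Rightarrow> rat" where
  "zeta_EMS ks =
     fls_nth (phi_plus (wcls (concat (map (\<lambda>k. replicate k Ld @ [Ly]) (rev ks))))) 0"

definition bernoulli_number :: "nat \<Rightarrow> rat" where
  "bernoulli_number m = fact m * fps_nth (fps_X / (fps_exp 1 - 1)) m"


section \<open>Formal power series in several variables\<close>

text \<open>The variables are indexed by natural numbers and a series may involve all of them;
  \<open>\<complex>[[t\<^sub>1, \<dots>, t\<^sub>n]]\<close> is the subring of the series whose exponents are supported
  in \<open>{1..n}\<close>.\<close>

typedef 'a mfps = "UNIV :: ((nat \<Rightarrow>\<^sub>0 nat) \<Rightarrow> 'a) set"
  morphisms mcoeff Mfps ..

setup_lifting type_definition_mfps

lemma finite_splittings: "finite {(a, b). a + b = (m :: nat \<Rightarrow>\<^sub>0 nat)}"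
proof -
  let ?A = "{a. \<exists>b. a + b = m}"
  have "inj_on Poly_Mapping.lookup ?A" by (auto simp: inj_on_def poly_mapping.lookup_inject)
  moreover have "Poly_Mapping.lookup ` ?A \<subseteq>
      {f. \<forall>x. (x \<in> Poly_Mapping.keys m \<longrightarrow> f x \<in> {..Max (Poly_Mapping.lookup m ` Poly_Mapping.keys m)}) \<and>
        (x \<notin> Poly_Mapping.keys m \<longrightarrow> f x = 0)}"
  proof clarify
    fix a b x assume m: "m = a + b"
    have le: "Poly_Mapping.lookup a x \<le> Poly_Mapping.lookup m x" by (simp add: m lookup_add)
    show "(x \<in> Poly_Mapping.keys (a + b) \<longrightarrow> Poly_Mapping.lookup a x
          \<in> {..Max (Poly_Mapping.lookup (a + b) ` Poly_Mapping.keys (a + b))}) \<and>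
        (x \<notin> Poly_Mapping.keys (a + b) \<longrightarrow> Poly_Mapping.lookup a x = 0)"
      using le by (fold m) (auto simp: in_keys_iff intro: order_trans[OF le] Max_ge)
  qed
  ultimately have fin: "finite ?A"
    by (rule inj_on_finite) (rule finite_set_of_finite_funs; simp)
  have "{(a, b). a + b = m} \<subseteq> (\<lambda>a. (a, m - a)) ` ?A" by auto
  then show ?thesis using fin finite_surj by blast
qed

instantiation mfps :: (comm_semiring_1) comm_semiring_1
begin

lift_definition zero_mfps :: "'a mfps" is "\<lambda>_. 0" .

lift_definition one_mfps :: "'a mfps" is "\<lambda>m. if m = 0 then 1 else 0" .

lift_definition plus_mfps :: "'a mfps \<Rightarrow> 'a mfps \<Rightarrow> 'a mfps" is "\<lambda>f g m. f m + g m" .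

lift_definition times_mfps :: "'a mfps \<Rightarrow> 'a mfps \<Rightarrow> 'a mfps" is
  "\<lambda>f g m. \<Sum>(a, b) | a + b = m. f a * g b" .

instance
proof
  fix f g h :: "'a mfps"
  have fin: "finite {p. case p of (a, b) \<Rightarrow> a + b = m}" for m :: "nat \<Rightarrow>\<^sub>0 nat"
    by (rule finite_splittings)
  show "f * g * h = f * (g * h)"
  proof (transfer, rule ext)
    fix f g h :: "(nat \<Rightarrow>\<^sub>0 nat) \<Rightarrow> 'a" and m
    have "(\<Sum>(a, b) | a + b = m. (\<Sum>(c, d) | c + d = a. f c * g d) * h b) =
        (\<Sum>(p, q)\<in>(SIGMA p:{(a, b). a + b = m}. {(c, d). c + d = fst p}). f (fst q) * g (snd q) * h (snd p))"
      by (subst sum.Sigma[symmetric]) (auto simp: fin fin[unfolded split_def] sum_distrib_right split_def intro!: sum.cong)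
    also have "\<dots> = (\<Sum>(p, q)\<in>(SIGMA p:{(a, b). a + b = m}. {(c, d). c + d = snd p}). f (fst p) * (g (fst q) * h (snd q)))"
      by (rule sum.reindex_bij_witness[where
            i = "\<lambda>(p, q). ((fst p + fst q, snd q), (fst p, fst q))" and
            j = "\<lambda>(p, q). ((fst q, snd q + snd p), (snd q, snd p))"])
        (auto simp: add.assoc mult.assoc)
    also have "\<dots> = (\<Sum>(a, b) | a + b = m. f a * (\<Sum>(c, d) | c + d = b. g c * h d))"
      by (subst sum.Sigma[symmetric]) (auto simp: fin fin[unfolded split_def] sum_distrib_left split_def intro!: sum.cong)
    finally show "(\<Sum>(a, b) | a + b = m. (\<Sum>(c, d) | c + d = a. f c * g d) * h b) =
        (\<Sum>(a, b) | a + b = m. f a * (\<Sum>(c, d) | c + d = b. g c * h d))" .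
  qed
  show "f * g = g * f"
    by (transfer, rule ext, rule sum.reindex_bij_witness[where i = prod.swap and j = prod.swap])
      (auto simp: ac_simps)
  show "1 * f = f"
  proof (transfer, rule ext)
    fix f :: "(nat \<Rightarrow>\<^sub>0 nat) \<Rightarrow> 'a" and m
    have "(\<Sum>(a, b) | a + b = m. (if a = 0 then 1 else 0) * f b) =
        (\<Sum>(a, b)\<in>{(0 :: nat \<Rightarrow>\<^sub>0 nat, m)}. (if a = 0 then 1 else 0) * f b)"
      by (rule sum.mono_neutral_right) (auto simp: fin split: if_splits)
    then show "(\<Sum>(a, b) | a + b = m. (if a = 0 then 1 else 0) * f b) = f m" by simp
  qed
  show "(f + g) * h = f * h + g * h"
    by (transfer, rule ext) (simp add: split_def distrib_right sum.distrib)
qed (transfer; auto simp: fun_eq_iff ac_simps)+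

end

definition mfps_var :: "nat \<Rightarrow> 'a::comm_semiring_1 mfps" where
  "mfps_var i = Mfps (\<lambda>m. if m = Poly_Mapping.single i 1 then 1 else 0)"

definition total_degree :: "(nat \<Rightarrow>\<^sub>0 nat) \<Rightarrow> nat" where
  "total_degree m = (\<Sum>i\<in>Poly_Mapping.keys m. Poly_Mapping.lookup m i)"

text \<open>Substitution of a series \<open>u\<close> without constant term, for which the powers \<open>u ^ k\<close> with
  \<open>k\<close> above the total degree of \<open>m\<close> do not contribute to the coefficient at \<open>m\<close>.\<close>

definition mfps_compose :: "'a::comm_semiring_1 fps \<Rightarrow> 'a mfps \<Rightarrow> 'a mfps" where
  "mfps_compose F u = Mfps (\<lambda>m. \<Sum>k\<le>total_degree m. fps_nth F k * mcoeff (u ^ k) m)"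

text \<open>Numerator and denominator both have order \<open>2\<close>, so the quotient is a power series.\<close>

definition ems_series :: "complex fps" where
  "ems_series = (fps_X - (fps_exp 1 - 1)) / (fps_X * (fps_exp 1 - 1))"

definition Z_EMS :: "nat \<Rightarrow> complex mfps" where
  "Z_EMS n = Mfps (\<lambda>m.
     if Poly_Mapping.keys m \<subseteq> {1..n}
     then (\<Prod>i=1..n. (-1) ^ Poly_Mapping.lookup m i / fact (Poly_Mapping.lookup m i)) *
       of_rat (zeta_EMS (map (Poly_Mapping.lookup m) [1..<Suc n]))
     else 0)"

end

theory Submission
  imports Defs
begin

text \<open>For a Laurent series \<open>f\<close> let \<open>\<chi>\<^sub>f\<close> be the character of \<open>\<H>\<^sub>0\<close> under which \<open>d\<close> acts as
  \<open>\<partial>\<^sub>z\<close> and \<open>y\<close> as multiplication by \<open>f\<close>. Both letters are primitive for the coproduct and \<open>\<partial>\<^sub>z\<close>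
  is a derivation, so \<open>\<chi>\<^sub>f * \<chi>\<^sub>g = \<chi>\<^bsub>f + g\<^esub>\<close>. Splitting \<open>x = -1/z + p\<close> into its polar and regular
  part therefore is the Birkhoff decomposition of \<open>\<phi> = \<chi>\<^sub>x\<close>: \<open>\<phi>\<^sub>- = \<chi>\<^bsub>1/z\<^esub>\<close> and
  \<open>\<phi>\<^sub>+ = \<chi>\<^sub>p\<close>. The renormalized value is thus the constant term of
  \<open>\<partial>\<^bsup>k\<^sub>n\<^esup>(p \<cdots> \<partial>\<^bsup>k\<^sub>1\<^esup>(p))\<close>, where \<open>p(-u) = 1/(e\<^sup>u - 1) - 1/u\<close>. The
  Leibniz rule distributes \<open>\<partial>\<^bsup>k\<^sub>i\<^esup>\<close> over the innermost \<open>i\<close> factors \<open>p\<close>; the array \<open>\<nu>\<close> records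
  how many of these derivatives each factor receives. The same sum arises by expanding the powers of
  \<open>t\<^sub>i + \<cdots> + t\<^sub>n\<close> in the product.\<close>

unbundle Formal_Power_Series.fps_syntax and Formal_Laurent_Series.fps_syntax

section \<open>The decomposition\<close>

text \<open>The ring and the operator are left open, so that the same recursion runs in Laurent
  series and, once the multiplier is regular, in power series.\<close>

primrec word_act :: "('a \<Rightarrow> 'a) \<Rightarrow> 'a \<Rightarrow> lword \<Rightarrow> 'a::comm_ring_1" where
  "word_act D x [] = 1"
| "word_act D x (l # w) = (case l of Ld \<Rightarrow> D (word_act D x w) | Ly \<Rightarrow> x * word_act D x w)"

abbreviation chi_word :: "rat fls \<Rightarrow> lword \<Rightarrow> rat fls" where
  "chi_word \<equiv> word_act fls_deriv"

abbreviation chi_free :: "rat fls \<Rightarrow> (lword \<Rightarrow>\<^sub>0 rat) \<Rightarrow> rat fls" where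
  "chi_free f \<equiv> lin_ext fscale (chi_word f)"

lemma chi_free_linear: "Vector_Spaces.linear qscale fscale (chi_free f)"
  by (rule lin_ext_linear) (rule fls.vector_space_axioms)

interpretation chi_free: Vector_Spaces.linear qscale fscale "chi_free f"
  by (rule chi_free_linear)

lemma chi_free_bas [simp]: "chi_free f (bas w) = chi_word f w"
  by (rule lin_ext_bas) (rule fls.vector_space_axioms)

lemma chi_free_pre:
  "chi_free f (pre Ld a) = fls_deriv (chi_free f a)"
  "chi_free f (pre Ly a) = f * chi_free f a"
proof -
  show "chi_free f (pre Ld a) = fls_deriv (chi_free f a)"
    using linear_eq_on_bas[OF Vector_Spaces.linear_compose[OF pre_linear chi_free_linear]
        Vector_Spaces.linear_compose[OF chi_free_linear fls_deriv_linear]] by simp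
  show "chi_free f (pre Ly a) = f * chi_free f a"
    using linear_eq_on_bas[OF Vector_Spaces.linear_compose[OF pre_linear chi_free_linear]
        Vector_Spaces.linear_compose[OF chi_free_linear fls_mult_linear]] by simp
qed

text \<open>When both words start with d, the recursive clause of the product becomes the Leibniz
  rule in the form \<open>D a * D b = D (a * D b) - a * D (D b)\<close>.\<close>

lemma chi_free_shw: "chi_free f (shw u v) = chi_word f u * chi_word f v"
  by (induction u v rule: shw.induct)
    (simp_all add: chi_free_pre chi_free.diff algebra_simps)

lemma chi_free_sh: "chi_free f (sh a b) = chi_free f a * chi_free f b"
  by (rule linear_sh_mult[OF chi_free_linear]) (simp_all add: chi_free_shw fscale_def)

lemma chi_word_snoc_Ld: "chi_word f (w @ [Ld]) = 0"
proof (induction w)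
  case (Cons x w) then show ?case by (cases x) auto
qed simp

text \<open>The kernel of a multiplicative map is an ideal. It contains the Leibniz defects because
  the derivative is a derivation, and the words ending in d because the derivative of 1 is 0. Hence
  the map descends to the quotient.\<close>

lemma chi_free_S_minus:
  assumes "a \<in> S_minus"
  shows "chi_free f a = 0"
proof (rule S_minus_ker[OF chi_free_linear _ _ _ assms])
  fix k u v
  have "chi_free f ((pre Ld ^^ k) a) = (fls_deriv ^^ k) (chi_free f a)" for a
    by (induction k) (auto simp: chi_free_pre)
  moreover have "chi_free f (leibniz_defect (bas u) (bas v)) = 0"
    by (simp add: leibniz_defect_def chi_free.diff chi_free_pre chi_free_sh chi_free_shw)
  moreover have "(fls_deriv ^^ k) (0 :: rat fls) = 0"
    by (induction k) auto
  ultimately show "chi_free f ((pre Ld ^^ k) (leibniz_defect (bas u) (bas v))) = 0"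
    by simp
qed (simp_all add: chi_free_sh chi_word_snoc_Ld)

lift_definition chi :: "rat fls \<Rightarrow> h0 \<Rightarrow> rat fls" is chi_free
  using chi_free_S_minus by (fastforce simp: chi_free.diff)

lemma chi_cls: "chi f (cls a) = chi_free f a"
  by (rule chi.abs_eq)

lemma chi_wcls [simp]: "chi f (wcls w) = chi_word f w"
  by (simp add: chi_cls)

lemma hlinear_chi: "hlinear (chi f)"
  by (unfold_locales; transfer) (simp_all add: chi_free.add chi_free.scale)

lemma phi_eq_chi: "phi = chi xz"
proof -
  have "phi_word w = chi_word xz w" for w
    by (induction w) (auto split: letter.split)
  then have "phi_word = chi_word xz" ..
  then show ?thesis by (simp add: phi_def chi_def)
qed

section \<open>Convolution of linear maps and of characters\<close>

lemma cls_surj: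
  obtains a where "h = cls a"
  using Quotient3_abs_rep[OF Quotient3_h0] by metis

lemma hlinear_cls:
  assumes "hlinear \<alpha>"
  shows "Vector_Spaces.linear qscale fscale (\<lambda>a. \<alpha> (cls a))"
  using hlinear_vanishing[OF assms] by (simp add: vanishing_def)

lemma hlinear_eqI:
  assumes "hlinear \<alpha>" "hlinear \<beta>" "\<And>w. \<alpha> (wcls w) = \<beta> (wcls w)"
  shows "\<alpha> = \<beta>"
proof
  fix h
  obtain a where h: "h = cls a" by (rule cls_surj)
  show "\<alpha> h = \<beta> h"
    unfolding h by (rule linear_eq_on_bas[OF hlinear_cls hlinear_cls]) (use assms in auto)
qed

lemma conv_wcls:
  assumes "hlinear \<alpha>" "hlinear \<beta>"
  shows "conv \<alpha> \<beta> (wcls w) = splits (\<lambda>u v. \<alpha> (wcls u) * \<beta> (wcls v)) w"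
  by (simp add: conv_cls pairing_coprod assms)

lemma hlinear_conv:
  assumes "hlinear \<alpha>" "hlinear \<beta>"
  shows "hlinear (conv \<alpha> \<beta>)"
proof -
  interpret F: Vector_Spaces.linear qscale fscale "conv_free (\<lambda>a. \<alpha> (cls a)) (\<lambda>a. \<beta> (cls a))"
    by (rule conv_free_linear)
  have eq: "conv \<alpha> \<beta> (cls a) = conv_free (\<lambda>a. \<alpha> (cls a)) (\<lambda>a. \<beta> (cls a)) a" for a
    by (simp add: conv_cls pairing_coprod assms)
  show ?thesis
  proof unfold_locales
    fix g h c
    obtain a b where "g = cls a" "h = cls b" by (meson cls_surj)
    then show "conv \<alpha> \<beta> (g + h) = conv \<alpha> \<beta> g + conv \<alpha> \<beta> h"
      "conv \<alpha> \<beta> (hscale c g) = fscale c (conv \<alpha> \<beta> g)"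
      by (simp_all add: plus_h0.abs_eq hscale.abs_eq eq F.add F.scale)
  qed
qed

text \<open>The first letter goes to the left or to the right part. For d the two contributions form
  the product rule, for y they add the multipliers \<open>f\<close> and \<open>g\<close>.\<close>

lemma splits_chi_word:
  "splits (\<lambda>u v. chi_word f u * chi_word g v) w = chi_word (f + g) w"
proof (induction w)
  case (Cons x w)
  have "splits (\<lambda>u v. chi_word f u * chi_word g v) (x # w) =
      splits (\<lambda>u v. chi_word f (x # u) * chi_word g v + chi_word f u * chi_word g (x # v)) w"
    by (simp add: splits_add)
  also have "\<dots> = chi_word (f + g) (x # w)"
  proof (cases x)
    case Ld
    have "fls_deriv (\<Sum>S\<in>A. B S) = (\<Sum>S\<in>A. fls_deriv (B S :: rat fls))" for A :: "nat set set" and B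
      by (induction A rule: infinite_finite_induct) auto
    then have "splits (\<lambda>u v. fls_deriv (B u v :: rat fls)) w = fls_deriv (splits B w)" for B
      by (simp add: splits_sum)
    from this[of "\<lambda>u v. chi_word f u * chi_word g v"] show ?thesis
      using Ld by (simp add: Cons.IH add.commute)
  next
    case Ly
    have "splits (\<lambda>u v. c * B u v :: rat fls) w = c * splits B w" for B c
      by (simp add: splits_sum sum_distrib_left)
    from this[of "f + g" "\<lambda>u v. chi_word f u * chi_word g v"] show ?thesis
      using Ly by (simp add: Cons.IH algebra_simps)
  qed
  finally show ?case .
qed simp

text \<open>Convolution of characters is addition of multipliers; in particular
  \<open>chi (- f)\<close> inverts \<open>chi f\<close>, and an additive splitting of
  \<open>xz\<close> factorizes \<open>phi\<close>.\<close>

lemma conv_chi: "conv (chi f) (chi g) = chi (f + g)"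
proof (rule hlinear_eqI)
  show "hlinear (conv (chi f) (chi g))" by (intro hlinear_conv hlinear_chi)
  show "hlinear (chi (f + g))" by (rule hlinear_chi)
  show "conv (chi f) (chi g) (wcls w) = chi (f + g) (wcls w)" for w
    by (subst conv_wcls[OF hlinear_chi hlinear_chi]) (simp add: splits_chi_word)
qed

lemma counit_wcls: "counit (wcls w) = (if w = [] then 1 else 0)"
  by (simp add: counit.abs_eq lookup_single)

lemma hlinear_conv_unit: "hlinear conv_unit"
proof unfold_locales
  fix g h c
  obtain a b where "g = cls a" "h = cls b" by (meson cls_surj)
  then show "conv_unit (g + h) = conv_unit g + conv_unit h"
    "conv_unit (hscale c g) = fscale c (conv_unit g)"
    by (simp_all add: plus_h0.abs_eq hscale.abs_eq conv_unit_def counit.abs_eq lookup_add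
        fls_plus_const fscale_def fls_const_mult_const)
qed

lemma conv_unit_eq_chi: "conv_unit = chi 0"
proof (rule hlinear_eqI[OF hlinear_conv_unit hlinear_chi])
  fix w show "conv_unit (wcls w) = chi 0 (wcls w)"
  proof (induction w)
    case (Cons x w) then show ?case
      by (cases x) (auto simp: conv_unit_def counit_wcls split: if_splits)
  qed (simp add: conv_unit_def counit_wcls)
qed

section \<open>Polar and regular Laurent series\<close>

lemma subspace_A_plus: "fls.subspace A_plus"
proof -
  have "fps_to_fls f + fps_to_fls g \<in> A_plus" "fscale c (fps_to_fls f) \<in> A_plus" for c and f g :: "rat fps"
    using rangeI[of fps_to_fls "f + g"] rangeI[of fps_to_fls "fps_const c * f"]
    by (simp_all add: A_plus_def fscale_def fls_times_fps_to_fls)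
  moreover have "0 \<in> A_plus"
    using rangeI[of fps_to_fls "0 :: rat fps"] by (simp add: A_plus_def)
  ultimately show ?thesis by (auto simp: fls.subspace_def A_plus_def)
qed

lemma subspace_A_minus: "fls.subspace A_minus"
  by (auto simp: fls.subspace_def A_minus_def fscale_def)

lemma A_minus_mult:
  assumes "f \<in> A_minus" "g \<in> A_minus"
  shows "f * g \<in> A_minus"
proof -
  have "(f * g) $$ n = 0" if "n \<ge> 0" for n
    unfolding fls_times_nth(1)
  proof (intro sum.neutral ballI)
    fix i
    \<comment> \<open>The two exponents add up to \<open>n\<close>, so they cannot both be
      negative.\<close>
    have "i - fls_subdegree g \<ge> 0 \<or> fls_subdegree g + n - i \<ge> 0" using that by linarith
    then show "f $$ (i - fls_subdegree g) * g $$ (fls_subdegree g + n - i) = 0"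
      using assms by (auto simp: A_minus_def)
  qed
  then show ?thesis by (simp add: A_minus_def)
qed

lemma A_plus_Int_A_minus: "f \<in> A_plus \<Longrightarrow> f \<in> A_minus \<Longrightarrow> f = 0"
  by (auto simp: A_plus_def A_minus_def fls_eq_iff)

text \<open>Polar series are closed under products and derivatives, and the innermost letter
  produces 0 or \<open>f\<close>, both polar.\<close>

lemma chi_word_A_minus:
  assumes "f \<in> A_minus" "w \<noteq> []"
  shows "chi_word f w \<in> A_minus"
  using assms(2)
proof (induction w)
  case (Cons x w)
  show ?case
  proof (cases "w = []")
    case True
    then show ?thesis using assms(1) by (cases x) (auto simp: A_minus_def)
  next
    case False
    with Cons.IH have "chi_word f w \<in> A_minus" by blast
    then show ?thesis
      using A_minus_mult[OF assms(1)] by (cases x) (auto simp: A_minus_def)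
  qed
qed simp

text \<open>Only the empty word has a value that is not polar, and its coefficient is the counit.
  This yields both range conditions on the polar factor in \<open>birkhoff\<close>.\<close>

lemma chi_free_A_minus:
  assumes "f \<in> A_minus"
  shows "chi_free f a - fls_const (Poly_Mapping.lookup a []) \<in> A_minus"
proof -
  have lin: "Vector_Spaces.linear qscale fscale (\<lambda>a. chi_free f a - fls_const (Poly_Mapping.lookup a []))"
  proof (rule linear_minus[OF chi_free_linear])
    show "Vector_Spaces.linear qscale fscale (\<lambda>a. fls_const (Poly_Mapping.lookup a []))"
      by unfold_locales (simp_all add: lookup_add fls_plus_const fscale_def fls_const_mult_const)
  qed
  interpret L: Vector_Spaces.linear qscale fscale "\<lambda>a. chi_free f a - fls_const (Poly_Mapping.lookup a [])"
    by (rule lin)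
  have "a \<in> (\<lambda>a. chi_free f a - fls_const (Poly_Mapping.lookup a [])) -` A_minus"
  proof (rule bas_in_subspace)
    fix w
    show "bas w \<in> (\<lambda>a. chi_free f a - fls_const (Poly_Mapping.lookup a [])) -` A_minus"
      using chi_word_A_minus[OF assms, of w] fls.subspace_0[OF subspace_A_minus]
      by (cases "w = []") (auto simp: lookup_single)
  qed (rule L.subspace_vimage[OF subspace_A_minus])
  then show ?thesis by simp
qed

lemma fps_to_fls_word_act: "fps_to_fls (word_act fps_deriv f w) = chi_word (fps_to_fls f) w"
  by (induction w) (auto simp: fls_times_fps_to_fls split: letter.split simp flip: fls_deriv_fps_to_fls)

lemma range_chi_A_plus: "range (chi (fps_to_fls f)) \<subseteq> A_plus"
proof -
  have "chi_free (fps_to_fls f) a \<in> A_plus" for a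
    using bas_in_subspace[OF chi_free.subspace_vimage[OF subspace_A_plus], of "fps_to_fls f" a]
    by (auto simp: A_plus_def simp flip: fps_to_fls_word_act)
  then have "chi (fps_to_fls f) h \<in> A_plus" for h
    by (transfer)
  then show ?thesis by auto
qed

section \<open>Existence and uniqueness of the Birkhoff decomposition\<close>

text \<open>The two trivial splittings are set apart; by \<open>interior_nths\<close> all others
  have two nonempty, strictly shorter parts, which permits induction on the length.\<close>

lemma splits_interior:
  assumes "w \<noteq> []"
  shows "splits B w = B w [] + B [] w +
    (\<Sum>S\<in>Pow {..<length w} - {{}, {..<length w}}. B (nths w S) (nths w ({..<length w} - S)))"
proof -
  let ?n = "{..<length w}"
  have ne: "{} \<noteq> ?n" using assms by auto
  have all: "nths w ?n = w" by (rule nths_all) simp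
  have "Pow ?n = insert ?n (insert {} (Pow ?n - {{}, ?n}))" by auto
  then have "splits B w = (\<Sum>S\<in>insert ?n (insert {} (Pow ?n - {{}, ?n})). B (nths w S) (nths w (?n - S)))"
    by (simp only: splits_sum)
  also have "\<dots> = B w [] + B [] w + (\<Sum>S\<in>Pow ?n - {{}, ?n}. B (nths w S) (nths w (?n - S)))"
    using ne by (simp add: all add.assoc)
  finally show ?thesis .
qed

lemma interior_nths:
  assumes "S \<in> Pow {..<length w} - {{}, {..<length w}}"
  shows "nths w S \<noteq> []" "length (nths w S) < length w"
    "nths w ({..<length w} - S) \<noteq> []" "length (nths w ({..<length w} - S)) < length w"
proof -
  have ne: "nths w S \<noteq> []" if "S \<noteq> {}" "S \<subseteq> {..<length w}" for S
  proof -
    have "set (nths w S) \<noteq> {}" using that by (auto simp: set_nths)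
    then show ?thesis by auto
  qed
  have len: "length (nths w S) + length (nths w ({..<length w} - S)) = length w"
  proof -
    have "length (nths w S) + length (nths w ({..<length w} - S)) =
        card ({i. i < length w \<and> i \<in> S} \<union> {i. i < length w \<and> i \<in> {..<length w} - S})"
      unfolding length_nths by (rule card_Un_disjoint[symmetric]) auto
    also have "{i. i < length w \<and> i \<in> S} \<union> {i. i < length w \<and> i \<in> {..<length w} - S} = {..<length w}"
      by auto
    finally show ?thesis by simp
  qed
  have S: "S \<noteq> {}" "S \<subseteq> {..<length w}" "{..<length w} - S \<noteq> {}" "{..<length w} - S \<subseteq> {..<length w}"
    using assms by auto
  show 1: "nths w S \<noteq> []" by (rule ne[OF S(1,2)])
  show 2: "nths w ({..<length w} - S) \<noteq> []" by (rule ne[OF S(3,4)])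
  from 1 2 have "0 < length (nths w S)" "0 < length (nths w ({..<length w} - S))" by simp_all
  with len show "length (nths w S) < length w" "length (nths w ({..<length w} - S)) < length w"
    by linarith+
qed

text \<open>The inverse of \<open>chi f\<close> is \<open>chi (- f)\<close>, and
  \<open>- f + fps_to_fls p = xz\<close>, so the convolution gives back \<open>phi\<close>.\<close>

lemma birkhoff_chi:
  assumes "f \<in> A_minus" "f + xz = fps_to_fls p"
  shows "birkhoff (chi f) (chi (fps_to_fls p))"
  unfolding birkhoff_def
proof (intro conjI hlinear_chi range_chi_A_plus exI)
  have *: "chi f h - fls_const (counit h) \<in> A_minus" for h
    using chi_free_A_minus[OF assms(1)] by (cases h rule: cls_surj) (simp add: chi_cls counit.abs_eq)
  show "range (chi f) \<subseteq> {fls_const c + g | c g. g \<in> A_minus}"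
  proof clarify
    fix h
    show "\<exists>c g. chi f h = fls_const c + g \<and> g \<in> A_minus"
      using *[of h] by (intro exI[of _ "counit h"] exI[of _ "chi f h - fls_const (counit h)"]) simp
  qed
  show "chi f ` {h. counit h = 0} \<subseteq> A_minus"
    using * by (auto simp: image_subset_iff) (metis diff_zero fls_const_0)
  show "conv_inverse (chi f) (chi (- f))"
    by (simp add: conv_inverse_def conv_chi conv_unit_eq_chi hlinear_chi)
  show "phi = conv (chi (- f)) (chi (fps_to_fls p))"
    by (simp add: phi_eq_chi conv_chi flip: assms(2))
qed simp

text \<open>\<open>conv_inverse\<close> puts no condition on the range of \<open>\<psi>\<close>. At
  a nonempty word the equation \<open>conv \<psi> \<phi>m = conv_unit\<close> expresses
  \<open>\<psi>\<close> through \<open>\<phi>m\<close> and through \<open>\<psi>\<close> on shorter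
  nonempty words, so every term is polar by induction.\<close>

lemma conv_inverse_A_minus:
  assumes "hlinear \<phi>m" "\<phi>m (wcls []) = 1" "\<phi>m ` {h. counit h = 0} \<subseteq> A_minus"
    and "conv_inverse \<phi>m \<psi>" "w \<noteq> []"
  shows "\<psi> (wcls w) \<in> A_minus"
  using assms(5)
proof (induction w rule: length_induct)
  case (1 w)
  have hl: "hlinear \<psi>" and 0: "\<psi> (wcls []) = 1" and "conv \<psi> \<phi>m (wcls w) = conv_unit (wcls w)"
    using assms(4) by (auto simp: conv_inverse_def)
  then have "splits (\<lambda>u v. \<psi> (wcls u) * \<phi>m (wcls v)) w = 0"
    using 1 by (simp add: conv_wcls assms conv_unit_def counit_wcls)
  moreover have m: "\<phi>m (wcls v) \<in> A_minus" if "v \<noteq> []" for v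
    using assms(3) that by (auto simp: counit_wcls)
  let ?I = "Pow {..<length w} - {{}, {..<length w}}"
  let ?B = "\<lambda>S. \<psi> (wcls (nths w S)) * \<phi>m (wcls (nths w ({..<length w} - S)))"
  have "sum ?B ?I \<in> A_minus"
  proof (intro fls.subspace_sum[OF subspace_A_minus] A_minus_mult)
    fix S assume S: "S \<in> ?I"
    show "\<psi> (wcls (nths w S)) \<in> A_minus" using 1(1) interior_nths[OF S] by blast
    show "\<phi>m (wcls (nths w ({..<length w} - S))) \<in> A_minus" using m interior_nths[OF S] by blast
  qed
  ultimately have "\<psi> (wcls w) = - (\<phi>m (wcls w) + sum ?B ?I)"
    unfolding eq_neg_iff_add_eq_0
    using 1(2) by (simp add: splits_interior assms(2) 0 add.assoc)
  also have "\<dots> \<in> A_minus"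
    using \<open>sum ?B ?I \<in> A_minus\<close> m[OF 1(2)]
    by (intro fls.subspace_neg fls.subspace_add subspace_A_minus)
  finally show ?case .
qed

text \<open>Induction on the length of words: the interior terms of the two factorizations agree,
  and the remaining equation identifies a polar with a regular difference, so both differences
  vanish.\<close>

lemma birkhoff_unique:
  assumes "birkhoff \<phi>m \<phi>p" "birkhoff \<phi>m' \<phi>p'"
  shows "\<phi>p = \<phi>p'"
proof -
  obtain \<psi> where \<psi>: "conv_inverse \<phi>m \<psi>" "phi = conv \<psi> \<phi>p"
    using assms(1) by (auto simp: birkhoff_def)
  obtain \<psi>' where \<psi>': "conv_inverse \<phi>m' \<psi>'" "phi = conv \<psi>' \<phi>p'"
    using assms(2) by (auto simp: birkhoff_def)
  have minus: "\<psi> (wcls w) \<in> A_minus" "\<psi>' (wcls w) \<in> A_minus" if "w \<noteq> []" for w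
    using assms conv_inverse_A_minus[OF _ _ _ \<psi>(1) that] conv_inverse_A_minus[OF _ _ _ \<psi>'(1) that]
    by (simp_all add: birkhoff_def)
  have plus: "\<phi>p h \<in> A_plus" "\<phi>p' h \<in> A_plus" for h
    using assms by (auto simp: birkhoff_def)
  have lin: "hlinear \<psi>" "hlinear \<psi>'" "hlinear \<phi>p" "hlinear \<phi>p'"
    and one: "\<psi> (wcls []) = 1" "\<psi>' (wcls []) = 1"
    using assms \<psi>(1) \<psi>'(1) by (auto simp: birkhoff_def conv_inverse_def)
  have eq: "splits (\<lambda>u v. \<psi> (wcls u) * \<phi>p (wcls v)) w = splits (\<lambda>u v. \<psi>' (wcls u) * \<phi>p' (wcls v)) w" for w
    using \<psi>(2) \<psi>'(2) by (simp flip: conv_wcls add: lin)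
  \<comment> \<open>\<open>birkhoff\<close> does not prescribe the regular factor at the empty word;
    its value 1 follows from the factorization there.\<close>
  have "phi (wcls []) = 1" by (simp add: phi_eq_chi)
  then have 0: "\<phi>p (wcls []) = 1" "\<phi>p' (wcls []) = 1"
    using arg_cong[OF \<psi>(2), of "\<lambda>f. f (wcls [])"] arg_cong[OF \<psi>'(2), of "\<lambda>f. f (wcls [])"]
    by (simp_all add: conv_wcls lin one)
  have "\<psi> (wcls w) = \<psi>' (wcls w) \<and> \<phi>p (wcls w) = \<phi>p' (wcls w)" for w
  proof (induction w rule: length_induct)
    case (1 w)
    show ?case
    proof (cases "w = []")
      case False
      let ?I = "Pow {..<length w} - {{}, {..<length w}}"
      have "(\<Sum>S\<in>?I. \<psi> (wcls (nths w S)) * \<phi>p (wcls (nths w ({..<length w} - S)))) =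
          (\<Sum>S\<in>?I. \<psi>' (wcls (nths w S)) * \<phi>p' (wcls (nths w ({..<length w} - S))))"
      proof (intro sum.cong refl)
        fix S assume S: "S \<in> ?I"
        show "\<psi> (wcls (nths w S)) * \<phi>p (wcls (nths w ({..<length w} - S))) =
          \<psi>' (wcls (nths w S)) * \<phi>p' (wcls (nths w ({..<length w} - S)))"
          by (simp add: 1 interior_nths(2,4)[OF S])
      qed
      with eq[of w] have *: "\<psi> (wcls w) - \<psi>' (wcls w) = \<phi>p' (wcls w) - \<phi>p (wcls w)"
        by (simp add: splits_interior[OF False] one 0 algebra_simps)
      have "\<psi> (wcls w) - \<psi>' (wcls w) \<in> A_minus"
        using minus[OF False] by (intro fls.subspace_diff subspace_A_minus)
      moreover have "\<psi> (wcls w) - \<psi>' (wcls w) \<in> A_plus"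
        unfolding * by (intro fls.subspace_diff subspace_A_plus plus)
      ultimately have "\<psi> (wcls w) - \<psi>' (wcls w) = 0" by (rule A_plus_Int_A_minus[rotated])
      with * show ?thesis by simp
    qed (simp add: one 0)
  qed
  then show ?thesis by (intro hlinear_eqI lin) blast
qed

lemma phi_plus_eq_chi:
  assumes "f \<in> A_minus" "f + xz = fps_to_fls p"
  shows "phi_plus = chi (fps_to_fls p)"
  unfolding phi_plus_def using birkhoff_chi[OF assms] birkhoff_unique
  by (intro the_equality) auto

section \<open>Bernoulli numbers\<close>

text \<open>The field is arbitrary because the renormalized values are rational while the generating
  function has complex coefficients.\<close>

definition bernoulli_fps :: "'a::field_char_0 fps" where
  "bernoulli_fps = fps_X / (fps_exp 1 - 1)"

lemma fps_exp_minus_1_neq_0: "fps_exp 1 - 1 \<noteq> (0 :: 'a::field_char_0 fps)"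
proof
  assume "fps_exp 1 - 1 = (0 :: 'a fps)"
  then have "(fps_exp 1 - 1 :: 'a fps) $ 1 = 0" by simp
  then show False by simp
qed

text \<open>The division is exact, since \<open>fps_exp 1 - 1\<close> has order 1.\<close>

lemma bernoulli_fps_mult: "bernoulli_fps * (fps_exp 1 - 1) = (fps_X :: 'a::field_char_0 fps)"
proof -
  have "subdegree (fps_exp 1 - 1 :: 'a fps) = 1"
    by (rule subdegreeI) (auto)
  then have "(fps_exp 1 - 1 :: 'a fps) dvd fps_X"
    by (subst fps_dvd_iff[OF fps_exp_minus_1_neq_0]) auto
  then show ?thesis by (simp add: bernoulli_fps_def)
qed

lemma bernoulli_fps_unique:
  assumes "f * (fps_exp 1 - 1) = (fps_X :: 'a::field_char_0 fps)"
  shows "f = bernoulli_fps"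
  using assms bernoulli_fps_mult fps_exp_minus_1_neq_0 mult_right_cancel by metis

lemma bernoulli_fps_0: "bernoulli_fps $ 0 = (1 :: 'a::field_char_0)"
proof -
  have "(bernoulli_fps * (fps_exp 1 - 1) :: 'a fps) $ 1 = 1" by (simp add: bernoulli_fps_mult)
  then show ?thesis by (simp add: fps_mult_nth)
qed

text \<open>The coefficientwise image of the rational series solves the same equation, whose
  solution is unique.\<close>

lemma bernoulli_fps_of_rat: "(bernoulli_fps :: 'a::field_char_0 fps) = Abs_fps (\<lambda>n. of_rat (bernoulli_fps $ n))"
proof (rule bernoulli_fps_unique[symmetric], rule fps_ext)
  fix n
  have "(Abs_fps (\<lambda>n. of_rat (bernoulli_fps $ n)) * (fps_exp 1 - 1) :: 'a fps) $ n =
      of_rat ((bernoulli_fps * (fps_exp 1 - 1)) $ n)"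
  proof -
    have "of_rat (fact k) = (fact k :: 'a)" for k by (metis of_nat_fact of_rat_of_nat_eq)
    then show ?thesis
      by (auto simp: fps_mult_nth of_rat_sum of_rat_mult of_rat_diff of_rat_divide intro!: sum.cong)
  qed
  then show "(Abs_fps (\<lambda>n. of_rat (bernoulli_fps $ n)) * (fps_exp 1 - 1) :: 'a fps) $ n = fps_X $ n"
    by (simp add: bernoulli_fps_mult)
qed

lemma bernoulli_number_Suc:
  "bernoulli_number (m + 1) / of_nat (m + 1) = fact m * bernoulli_fps $ Suc m"
  by (simp add: bernoulli_number_def bernoulli_fps_def field_simps)

text \<open>With \<open>b(u) = u / (e^u - 1)\<close> the series is \<open>(b(u) - 1) / u\<close>, a
  power series because \<open>b\<close> has constant term 1.\<close>

lemma ems_series_nth: "ems_series $ n = of_rat (bernoulli_fps $ Suc n)"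
proof -
  have "fps_X * fps_shift 1 bernoulli_fps = (bernoulli_fps - 1 :: complex fps)"
    by (rule fps_ext) (simp add: bernoulli_fps_0)
  then have "fps_shift 1 bernoulli_fps * (fps_X * (fps_exp 1 - 1)) = (bernoulli_fps - 1 :: complex fps) * (fps_exp 1 - 1)"
    by (simp add: mult_ac)
  also have "\<dots> = fps_X - (fps_exp 1 - 1)"
    by (simp add: left_diff_distrib bernoulli_fps_mult)
  finally have *: "ems_series = fps_shift 1 bernoulli_fps"
    unfolding ems_series_def using fps_exp_minus_1_neq_0
    by (metis fps_X_neq_zero mult_eq_0_iff nonzero_mult_div_cancel_right)
  show ?thesis by (simp add: * bernoulli_fps_of_rat[where 'a = complex])
qed

section \<open>The regular part of x and the renormalized values\<close>

text \<open>This is \<open>(1 - b(-z)) / z\<close> for the Bernoulli series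
  \<open>b\<close>.\<close>

definition xz_regular :: "rat fps" where
  "xz_regular = Abs_fps (\<lambda>n. (-1) ^ n * bernoulli_fps $ Suc n)"

text \<open>\<open>x = 1 / (e^(-z) - 1) = - b(-z) / z\<close>; the constant term 1 of
  \<open>b\<close> accounts for the pole.\<close>

lemma fls_X_inv_plus_xz: "fls_X_inv + xz = fps_to_fls xz_regular"
proof -
  define b :: "rat fps" where "b = bernoulli_fps oo (- fps_X)"
  have "b * ((fps_exp 1 - 1) oo (- fps_X)) = - fps_X"
    unfolding b_def by (subst fps_compose_mult_distrib[symmetric]) (simp_all add: bernoulli_fps_mult)
  moreover have "fps_exp 1 oo (- fps_X) = (fps_exp (-1) :: rat fps)"
    using fps_exp_compose_linear[of 1 "-1 :: rat"] by (simp add: fps_const_neg[symmetric] del: fps_const_neg)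
  ultimately have "b * (fps_exp (-1) - 1) = - fps_X"
    by (simp add: fps_compose_sub_distrib)
  \<comment> \<open>Multiplication by \<open>e^z\<close> turns \<open>e^(-z) - 1\<close> into the
    denominator \<open>1 - e^z\<close> of \<open>xz\<close>.\<close>
  then have "b * ((fps_exp (-1) - 1) * fps_exp 1) = - fps_X * fps_exp 1"
    by (simp add: mult.assoc[symmetric])
  moreover have "(fps_exp (-1) - 1) * fps_exp 1 = (1 - fps_exp 1 :: rat fps)"
    by (simp add: left_diff_distrib fps_exp_add_mult[symmetric])
  ultimately have *: "fps_X * fps_exp 1 = - (b * (1 - fps_exp 1) :: rat fps)"
    by simp
  have "b = 1 - fps_X * xz_regular"
  proof (rule fps_ext)
    fix n
    have "b $ n = (-1) ^ n * bernoulli_fps $ n"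
      unfolding b_def by (simp add: fps_compose_uminus')
    then show "b $ n = (1 - fps_X * xz_regular) $ n"
      by (cases n) (auto simp: xz_regular_def bernoulli_fps_0)
  qed
  with * have "fps_X * fps_exp 1 = (fps_X * xz_regular - 1) * (1 - fps_exp 1)"
    by (simp add: algebra_simps)
  then have "fps_to_fls (fps_X * fps_exp 1) = fps_to_fls ((fps_X * xz_regular - 1) * (1 - fps_exp 1))"
    by (rule arg_cong)
  then have e: "fls_X * fps_to_fls (fps_exp 1) =
      (fls_X * fps_to_fls xz_regular - 1) * (1 - fps_to_fls (fps_exp 1))"
    by (simp add: fls_times_fps_to_fls)
  have ne: "1 - fps_to_fls (fps_exp 1) \<noteq> (0 :: rat fls)"
    using fps_exp_minus_1_neq_0[where 'a = rat] by (simp flip: fps_to_fls_eq_1_iff)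
  have "fls_X * xz = fls_X * fps_to_fls xz_regular - 1"
    unfolding xz_def using e ne by (simp add: field_simps)
  then have "fls_X_inv * (fls_X * xz) = fls_X_inv * (fls_X * fps_to_fls xz_regular - 1)"
    by (rule arg_cong)
  moreover have "fls_X_inv * fls_X = (1 :: rat fls)"
    by (simp add: fls_X_inv_times_conv_shift)
  ultimately have "xz = fps_to_fls xz_regular - fls_X_inv"
    by (simp add: right_diff_distrib mult.assoc[symmetric])
  then show ?thesis by (metis add.commute diff_add_cancel)
qed

lemma zeta_EMS_eq:
  "zeta_EMS ks = word_act fps_deriv xz_regular (concat (map (\<lambda>k. replicate k Ld @ [Ly]) (rev ks))) $ 0"
proof -
  have "fls_X_inv \<in> A_minus" by (simp add: A_minus_def)
  then have "phi_plus = chi (fps_to_fls xz_regular)"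
    by (rule phi_plus_eq_chi) (rule fls_X_inv_plus_xz)
  then have "phi_plus (wcls w) = fps_to_fls (word_act fps_deriv xz_regular w)" for w
    by (metis chi_wcls fps_to_fls_word_act)
  then show ?thesis by (simp add: zeta_EMS_def)
qed

section \<open>Coefficients of finite products\<close>

text \<open>Functions are extensional, so each decomposition of \<open>m\<close> indexed by
  \<open>A\<close> occurs exactly once.\<close>

definition tuples :: "'i set \<Rightarrow> 'm::comm_monoid_add \<Rightarrow> ('i \<Rightarrow> 'm) set" where
  "tuples A m = {\<mu> \<in> A \<rightarrow>\<^sub>E UNIV. (\<Sum>i\<in>A. \<mu> i) = m}"

lemma bij_betw_tuples_insert:
  fixes m :: "'m::comm_monoid_add"
  assumes "finite A" "a \<notin> A"
  shows "bij_betw (\<lambda>((p, q), \<mu>). \<mu>(a := p)) (SIGMA (p, q) : {(p, q). p + q = m}. tuples A q)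
    (tuples (insert a A) m)"
proof -
  have upd: "(\<Sum>i\<in>A. if i = a then p else \<mu> i) = (\<Sum>i\<in>A. \<mu> i)" for \<mu> :: "_ \<Rightarrow> 'm" and p
    using assms(2) by (intro sum.cong) auto
  have cancel: "\<mu>(a := undefined) = \<mu>" if "\<mu> \<in> A \<rightarrow>\<^sub>E UNIV" for \<mu> :: "_ \<Rightarrow> 'm"
    using that assms(2) by (auto simp: PiE_def extensional_def)
  show ?thesis
    \<comment> \<open>The inverse records the entry at \<open>a\<close> and the sum of the others,
      and resets the value at \<open>a\<close> to \<open>undefined\<close>.\<close>
    by (rule bij_betw_byWitness[where f' = "\<lambda>\<mu>. ((\<mu> a, \<Sum>i\<in>A. \<mu> i), \<mu>(a := undefined))"])
      (auto simp: tuples_def assms upd cancel PiE_def extensional_def)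
qed

lemma tuples_empty: "tuples {} m = (if m = 0 then {\<lambda>_. undefined} else {})"
  by (auto simp: tuples_def)

lemma finite_tuples:
  assumes "finite A" "\<And>m :: 'm::comm_monoid_add. finite {(p, q). p + q = m}"
  shows "finite (tuples A (m :: 'm))"
  using assms(1)
proof (induction A arbitrary: m)
  case (insert a A)
  have "finite (SIGMA (p, q) : {(p, q). p + q = m}. tuples A q)"
    by (intro finite_SigmaI assms(2)) (auto simp: insert.IH)
  then show ?case
    using bij_betw_finite[OF bij_betw_tuples_insert[OF insert.hyps]] by blast
qed (simp add: tuples_empty)

text \<open>Any family \<open>c\<close> that turns products into convolutions is covered: below,
  divided powers of a derivation (\<open>m\<close> a number) and coefficients of series in several
  variables (\<open>m\<close> an exponent).\<close>

lemma prod_tuples: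
  fixes c :: "'m::comm_monoid_add \<Rightarrow> 'r::comm_monoid_mult \<Rightarrow> 's::comm_semiring_1"
  assumes fin: "\<And>m :: 'm. finite {(p, q). p + q = m}"
    and one: "\<And>m. c m 1 = (if m = 0 then 1 else 0)"
    and mult: "\<And>m f g. c m (f * g) = (\<Sum>(p, q) | p + q = m. c p f * c q g)"
    and "finite A"
  shows "c m (\<Prod>i\<in>A. f i) = (\<Sum>\<mu>\<in>tuples A m. \<Prod>i\<in>A. c (\<mu> i) (f i))"
  using assms(4)
proof (induction A arbitrary: m)
  case empty
  then show ?case by (simp add: tuples_empty one)
next
  case (insert a A)
  have upd: "(\<Prod>i\<in>insert a A. c ((\<mu>(a := p)) i) (f i)) = c p (f a) * (\<Prod>i\<in>A. c (\<mu> i) (f i))" for \<mu> p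
    using insert.hyps by (simp, intro arg_cong2[where f = "(*)"] prod.cong) auto
  have "c m (\<Prod>i\<in>insert a A. f i) =
      (\<Sum>(p, q) | p + q = m. \<Sum>\<mu>\<in>tuples A q. c p (f a) * (\<Prod>i\<in>A. c (\<mu> i) (f i)))"
    using insert.hyps by (simp add: mult insert.IH sum_distrib_left)
  also have "\<dots> = (\<Sum>x | fst x + snd x = m. \<Sum>\<mu>\<in>tuples A (snd x). \<Prod>i\<in>insert a A. c ((\<mu>(a := fst x)) i) (f i))"
    unfolding upd by (simp add: split_def)
  also have "\<dots> = (\<Sum>(x, \<mu>)\<in>(SIGMA x : {x. fst x + snd x = m}. tuples A (snd x)).
      \<Prod>i\<in>insert a A. c ((\<mu>(a := fst x)) i) (f i))"
    by (intro sum.Sigma ballI finite_tuples insert.hyps(1) fin fin[unfolded split_def])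
  also have "\<dots> = (\<Sum>\<mu>\<in>tuples (insert a A) m. \<Prod>i\<in>insert a A. c (\<mu> i) (f i))"
    using sum.reindex_bij_betw[OF bij_betw_tuples_insert[OF insert.hyps, of m],
        of "\<lambda>\<mu>. \<Prod>i\<in>insert a A. c (\<mu> i) (f i)"]
    by (simp only: split_def)
  finally show ?case .
qed


section \<open>Iterated derivatives of products\<close>

text \<open>Divided powers of the derivation: they turn the Leibniz rule into a convolution.\<close>

definition fps_divderiv :: "nat \<Rightarrow> 'a::field_char_0 fps \<Rightarrow> 'a fps" where
  "fps_divderiv k f = fps_const (1 / fact k) * fps_nth_deriv k f"

lemma fps_deriv_divderiv: "fps_deriv (fps_divderiv k f) = of_nat (Suc k) * fps_divderiv (Suc k) f"
proof -
  have "of_nat (Suc k) = fps_const (of_nat (Suc k) :: 'a)" by (rule fps_of_nat[symmetric])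
  then have "of_nat (Suc k) * fps_divderiv (Suc k) f =
      fps_const (of_nat (Suc k) * (1 / fact (Suc k))) * fps_nth_deriv (Suc k) f"
    unfolding fps_divderiv_def by (simp only: fps_const_mult mult.assoc[symmetric])
  also have "of_nat (Suc k) * (1 / fact (Suc k)) = (1 / fact k :: 'a)"
    by (simp add: field_simps del: of_nat_Suc)
  finally show ?thesis
    by (simp only: fps_divderiv_def fps_nth_deriv_commute fps_deriv_mult_const_left)
qed

text \<open>Differentiating the formula for \<open>k\<close> gives \<open>Suc k\<close> times the
  formula for \<open>Suc k\<close>, and this factor cancels in characteristic 0.\<close>

lemma fps_divderiv_mult_atMost:
  "fps_divderiv k (f * g) = (\<Sum>p\<le>k. fps_divderiv p f * fps_divderiv (k - p) g)"
proof (induction k)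
  case (Suc k)
  let ?T = "\<lambda>p. fps_divderiv p f * fps_divderiv (Suc k - p) g"
  have "of_nat (Suc k) * fps_divderiv (Suc k) (f * g) =
      (\<Sum>p\<le>k. fps_deriv (fps_divderiv p f * fps_divderiv (k - p) g))"
    by (simp only: fps_deriv_divderiv[symmetric] Suc.IH fps_deriv_sum)
  also have "\<dots> = (\<Sum>p\<le>k. of_nat (Suc p) * ?T (Suc p)) + (\<Sum>p\<le>k. of_nat (Suc k - p) * ?T p)"
    unfolding sum.distrib[symmetric]
    by (intro sum.cong refl) (simp add: fps_deriv_divderiv Suc_diff_le algebra_simps del: of_nat_Suc)
  \<comment> \<open>Both sums extend to \<open>p \<le> Suc k\<close> by a term of weight 0; then the
    weights \<open>p\<close> and \<open>Suc k - p\<close> add up to \<open>Suc k\<close>.\<close>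
  also have "(\<Sum>p\<le>k. of_nat (Suc p) * ?T (Suc p)) = (\<Sum>p\<le>Suc k. of_nat p * ?T p)"
    by (subst sum.atMost_Suc_shift) simp
  also have "(\<Sum>p\<le>k. of_nat (Suc k - p) * ?T p) = (\<Sum>p\<le>Suc k. of_nat (Suc k - p) * ?T p)"
    by simp
  also have "(\<Sum>p\<le>Suc k. of_nat p * ?T p) + (\<Sum>p\<le>Suc k. of_nat (Suc k - p) * ?T p) =
      (\<Sum>p\<le>Suc k. of_nat (Suc k) * ?T p)"
    unfolding sum.distrib[symmetric]
    by (intro sum.cong refl) (simp add: distrib_right[symmetric] of_nat_add[symmetric] del: of_nat_Suc of_nat_add)
  also have "\<dots> = of_nat (Suc k) * (\<Sum>p\<le>Suc k. ?T p)"
    by (rule sum_distrib_left[symmetric])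
  finally show ?case
    by (metis mult_left_cancel of_nat_eq_0_iff nat.distinct(1))
qed (simp add: fps_divderiv_def)

lemma nat_splittings: "{(p, q). p + q = k} = (\<lambda>p. (p, k - p)) ` {..k :: nat}"
  by (auto simp: image_iff)

lemma fps_divderiv_mult:
  "fps_divderiv k (f * g) = (\<Sum>(p, q) | p + q = k. fps_divderiv p f * fps_divderiv q g)"
  unfolding nat_splittings fps_divderiv_mult_atMost by (subst sum.reindex) (auto simp: inj_on_def)

lemma fps_divderiv_prod:
  "finite A \<Longrightarrow> fps_divderiv k (\<Prod>i\<in>A. f i) = (\<Sum>\<mu>\<in>tuples A k. \<Prod>i\<in>A. fps_divderiv (\<mu> i) (f i))"
  by (rule prod_tuples) (auto simp: nat_splittings fps_divderiv_mult, auto simp: fps_divderiv_def)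

lemma fps_nth_deriv_add_order: "fps_nth_deriv (a + b) f = fps_nth_deriv a (fps_nth_deriv b f)"
  by (induction a arbitrary: b f) (simp_all add: fps_nth_deriv_commute del: fps_nth_deriv.simps(2))

lemma fps_nth_deriv_eq_divderiv: "fps_nth_deriv k f = fps_const (fact k) * fps_divderiv k f"
  by (simp add: fps_divderiv_def mult.assoc[symmetric])

lemma fps_divderiv_const_nth_deriv:
  "fps_divderiv k (fps_const c * fps_nth_deriv s f) = fps_const (c / fact k) * fps_nth_deriv (k + s) f"
  by (simp add: fps_divderiv_def fps_nth_deriv_add_order mult.assoc[symmetric])

lemma fps_divderiv_sum: "fps_divderiv k (\<Sum>i\<in>A. f i) = (\<Sum>i\<in>A. fps_divderiv k (f i))"
  by (simp add: fps_divderiv_def fps_nth_deriv_sum sum_distrib_left)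

lemma fps_divderiv_const_mult: "fps_divderiv k (fps_const c * f) = fps_const c * fps_divderiv k f"
  by (simp add: fps_divderiv_def mult_ac)

section \<open>Triangular arrays and the formula for the values\<close>

definition triangle :: "nat \<Rightarrow> (nat \<times> nat) set" where
  "triangle n = {(i, j). 1 \<le> i \<and> i \<le> j \<and> j \<le> n}"

text \<open>\<open>\<nu> (i, j)\<close> will count the derivatives from the block of order
  \<open>k j\<close> that hit the \<open>i\<close>-th factor from the inside, and in the generating
  function the exponent of the \<open>j\<close>-th variable taken from the \<open>i\<close>-th
  factor.\<close>

definition triangular_arrays :: "nat \<Rightarrow> (nat \<Rightarrow> nat) \<Rightarrow> (nat \<times> nat \<Rightarrow> nat) set" where
  "triangular_arrays n k =
     {\<nu>. \<nu> \<in> triangle n \<rightarrow>\<^sub>E UNIV \<and> (\<forall>i\<in>{1..n}. (\<Sum>a=1..i. \<nu> (a, i)) = k i)}"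

text \<open>Splits off the last column, a tuple of \<open>Suc n\<close> entries with sum
  \<open>k (Suc n)\<close>.\<close>

lemma sum_triangular_arrays_Suc:
  "(\<Sum>\<nu>\<in>triangular_arrays (Suc n) k. g \<nu>) =
   (\<Sum>\<nu>\<in>triangular_arrays n k. \<Sum>\<mu>\<in>tuples {1..Suc n} (k (Suc n)).
      g (\<lambda>(i, j). if j = Suc n then \<mu> i else \<nu> (i, j)))"
  unfolding sum.cartesian_product
proof (rule sum.reindex_bij_witness[where
      j = "\<lambda>\<nu>. (restrict \<nu> (triangle n), \<lambda>i\<in>{1..Suc n}. \<nu> (i, Suc n))" and
      i = "\<lambda>(\<nu>, \<mu>) (i, j). if j = Suc n then \<mu> i else \<nu> (i, j)"])
  fix \<nu> assume \<nu>: "\<nu> \<in> triangular_arrays (Suc n) k"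
  show eq: "(case (restrict \<nu> (triangle n), \<lambda>i\<in>{1..Suc n}. \<nu> (i, Suc n)) of
      (\<nu>, \<mu>) \<Rightarrow> \<lambda>(i, j). if j = Suc n then \<mu> i else \<nu> (i, j)) = \<nu>"
    using \<nu> by (auto simp: fun_eq_iff triangular_arrays_def triangle_def PiE_def extensional_def)
  have "(\<Sum>a=1..i. restrict \<nu> (triangle n) (a, i)) = (\<Sum>a=1..i. \<nu> (a, i))" if "i \<le> n" for i
    using that by (intro sum.cong) (auto simp: triangle_def)
  then have "restrict \<nu> (triangle n) \<in> triangular_arrays n k"
    using \<nu> by (simp add: triangular_arrays_def)
  moreover have "(\<Sum>i=1..Suc n. \<nu> (i, Suc n)) = k (Suc n)"
    using \<nu> unfolding triangular_arrays_def by fastforce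
  then have "(\<lambda>i\<in>{1..Suc n}. \<nu> (i, Suc n)) \<in> tuples {1..Suc n} (k (Suc n))"
    unfolding tuples_def by (simp only: mem_Collect_eq restrict_PiE_iff restrict_apply' UNIV_I ball_triv simp_thms cong: sum.cong)
  ultimately show "(restrict \<nu> (triangle n), \<lambda>i\<in>{1..Suc n}. \<nu> (i, Suc n)) \<in>
      triangular_arrays n k \<times> tuples {1..Suc n} (k (Suc n))"
    by blast
  show "(case (restrict \<nu> (triangle n), \<lambda>i\<in>{1..Suc n}. \<nu> (i, Suc n)) of
      (\<nu>, \<mu>) \<Rightarrow> g (\<lambda>(i, j). if j = Suc n then \<mu> i else \<nu> (i, j))) = g \<nu>"
    using eq by simp
next
  fix x assume "x \<in> triangular_arrays n k \<times> tuples {1..Suc n} (k (Suc n))"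
  then obtain \<nu> \<mu> where x: "x = (\<nu>, \<mu>)" and \<nu>: "\<nu> \<in> triangle n \<rightarrow>\<^sub>E UNIV"
    "\<And>i. i \<in> {1..n} \<Longrightarrow> (\<Sum>a=1..i. \<nu> (a, i)) = k i"
    and \<mu>: "\<mu> \<in> {1..Suc n} \<rightarrow>\<^sub>E UNIV" "(\<Sum>i=1..Suc n. \<mu> i) = k (Suc n)"
    by (auto simp: triangular_arrays_def tuples_def)
  let ?m = "\<lambda>(i, j). if j = Suc n then \<mu> i else \<nu> (i, j)"
  have "?m \<in> triangle (Suc n) \<rightarrow>\<^sub>E UNIV"
    \<comment> \<open>Outside their domains \<open>\<nu>\<close> and \<open>\<mu>\<close> are
      \<open>undefined\<close>, so the glued array is extensional.\<close>
    using \<nu>(1) \<mu>(1) by (auto simp: PiE_def extensional_def triangle_def)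
  moreover have "(\<Sum>a=1..i. ?m (a, i)) = k i" if "i \<in> {1..Suc n}" for i
    using \<nu>(2)[of i] \<mu>(2) that by (cases "i = Suc n") auto
  ultimately show "(case x of (\<nu>, \<mu>) \<Rightarrow> \<lambda>(i, j). if j = Suc n then \<mu> i else \<nu> (i, j)) \<in> triangular_arrays (Suc n) k"
    by (simp add: triangular_arrays_def x)
  show "(restrict (case x of (\<nu>, \<mu>) \<Rightarrow> \<lambda>(i, j). if j = Suc n then \<mu> i else \<nu> (i, j)) (triangle n),
      \<lambda>i\<in>{1..Suc n}. (case x of (\<nu>, \<mu>) \<Rightarrow> \<lambda>(i, j). if j = Suc n then \<mu> i else \<nu> (i, j)) (i, Suc n)) = x"
    using \<nu>(1) \<mu>(1) by (auto simp: x fun_eq_iff PiE_def extensional_def triangle_def restrict_def)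
qed

lemma triangular_arrays_0: "triangular_arrays 0 k = {\<lambda>_. undefined}"
proof -
  have "triangle 0 = {}" by (auto simp: triangle_def)
  then show ?thesis by (simp add: triangular_arrays_def)
qed

lemma word_act_replicate_Ld:
  "word_act fps_deriv f (replicate m Ld @ w) = fps_nth_deriv m (word_act fps_deriv f w)"
  by (induction m) (simp_all add: fps_nth_deriv_commute del: fps_nth_deriv.simps(2))

text \<open>Induction from the inside out: each step multiplies by one more \<open>f\<close> and
  then distributes \<open>k (Suc n)\<close> derivatives over all \<open>Suc n\<close> factors, which
  creates the last column.\<close>

lemma word_act_fps_deriv:
  fixes f :: "'a::field_char_0 fps"
  shows "word_act fps_deriv f (concat (map (\<lambda>k. replicate k Ld @ [Ly]) (rev (map k [1..<Suc n])))) =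
    fps_const (\<Prod>i=1..n. fact (k i)) * (\<Sum>\<nu>\<in>triangular_arrays n k.
      \<Prod>i=1..n. fps_const (\<Prod>j=i..n. 1 / fact (\<nu> (i, j))) * fps_nth_deriv (\<Sum>j=i..n. \<nu> (i, j)) f)"
    (is "?W n = fps_const (?K n) * (\<Sum>\<nu>\<in>triangular_arrays n k. ?P n \<nu>)")
proof (induction n)
  case 0
  then show ?case by (simp add: triangular_arrays_0)
next
  case (Suc n)
  \<comment> \<open>For \<open>i = Suc n\<close> the ranges of \<open>j\<close> are empty, so this
    factor is the new \<open>f\<close> before any differentiation.\<close>
  let ?Q = "\<lambda>\<nu>. \<Prod>i=1..Suc n. fps_const (\<Prod>j=i..n. 1 / fact (\<nu> (i, j))) * fps_nth_deriv (\<Sum>j=i..n. \<nu> (i, j)) f"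
  have "?W (Suc n) = fps_nth_deriv (k (Suc n)) (f * ?W n)"
    by (simp add: word_act_replicate_Ld)
  also have "f * ?W n = fps_const (?K n) * (\<Sum>\<nu>\<in>triangular_arrays n k. ?Q \<nu>)"
    unfolding Suc.IH by (simp add: sum_distrib_left mult_ac)
  \<comment> \<open>Passing to divided powers costs \<open>fact (k (Suc n))\<close>, the new factor
    of \<open>?K (Suc n)\<close>.\<close>
  also have "fps_nth_deriv (k (Suc n)) (fps_const (?K n) * (\<Sum>\<nu>\<in>triangular_arrays n k. ?Q \<nu>)) =
      fps_const (?K (Suc n)) * (\<Sum>\<nu>\<in>triangular_arrays n k. fps_divderiv (k (Suc n)) (?Q \<nu>))"
    by (simp add: fps_nth_deriv_eq_divderiv fps_divderiv_const_mult fps_divderiv_sum mult_ac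
        flip: fps_const_mult)
  also have "(\<Sum>\<nu>\<in>triangular_arrays n k. fps_divderiv (k (Suc n)) (?Q \<nu>)) =
      (\<Sum>\<nu>\<in>triangular_arrays n k. \<Sum>\<mu>\<in>tuples {1..Suc n} (k (Suc n)).
         ?P (Suc n) (\<lambda>(i, j). if j = Suc n then \<mu> i else \<nu> (i, j)))"
  proof (intro sum.cong refl)
    fix \<nu>
    \<comment> \<open>A divided power of order \<open>\<mu> i\<close> raises the order of factor
      \<open>i\<close> by \<open>\<mu> i\<close> and divides by
      \<open>fact (\<mu> i)\<close>.\<close>
    have "fps_const ((\<Prod>j=i..n. 1 / fact (\<nu> (i, j))) / fact (\<mu> i)) * fps_nth_deriv (\<mu> i + (\<Sum>j=i..n. \<nu> (i, j))) f =
        fps_const (\<Prod>j=i..Suc n. 1 / fact (if j = Suc n then \<mu> i else \<nu> (i, j))) *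
        fps_nth_deriv (\<Sum>j=i..Suc n. if j = Suc n then \<mu> i else \<nu> (i, j)) f"
      if "i \<in> {1..Suc n}" for i and \<mu> :: "nat \<Rightarrow> nat"
    proof -
      have "(\<Prod>j=i..n. 1 / fact (if j = Suc n then \<mu> i else \<nu> (i, j))) = (\<Prod>j=i..n. 1 / fact (\<nu> (i, j)) :: 'a)"
        "(\<Sum>j=i..n. if j = Suc n then \<mu> i else \<nu> (i, j)) = (\<Sum>j=i..n. \<nu> (i, j))"
        by (auto intro: prod.cong sum.cong)
      then show ?thesis using that by (simp add: add.commute)
    qed
    then show "fps_divderiv (k (Suc n)) (?Q \<nu>) =
      (\<Sum>\<mu>\<in>tuples {1..Suc n} (k (Suc n)). ?P (Suc n) (\<lambda>(i, j). if j = Suc n then \<mu> i else \<nu> (i, j)))"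
      by (simp only: fps_divderiv_prod finite_atLeastAtMost fps_divderiv_const_nth_deriv split_conv
          cong: prod.cong)
  qed
  finally show ?case by (simp only: sum_triangular_arrays_Suc)
qed

lemma sum_triangle_swap:
  fixes n :: nat
  shows "(\<Sum>i=1..n. \<Sum>j=i..n. h i j) = (\<Sum>j=1..n. \<Sum>i=1..j. h i j :: 'a::comm_monoid_add)"
proof -
  have "(\<Sum>i=1..n. \<Sum>j=i..n. h i j) = (\<Sum>i\<in>{1..n}. \<Sum>j | j \<in> {1..n} \<and> i \<le> j. h i j)"
    by (intro sum.cong) auto
  also have "\<dots> = (\<Sum>j\<in>{1..n}. \<Sum>i | i \<in> {1..n} \<and> i \<le> j. h i j)"
    by (rule sum.swap_restrict) auto
  also have "\<dots> = (\<Sum>j=1..n. \<Sum>i=1..j. h i j)"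
    by (intro sum.cong) auto
  finally show ?thesis .
qed

text \<open>The constant term of an \<open>s\<close>-fold derivative is \<open>fact s\<close> times
  the coefficient at \<open>s\<close>; for \<open>xz_regular\<close> this is a Bernoulli quotient
  with sign \<open>(-1) ^ s\<close>.\<close>

lemma zeta_EMS_formula:
  "zeta_EMS (map k [1..<Suc n]) = (-1) ^ (\<Sum>i=1..n. k i) *
     (\<Sum>\<nu>\<in>triangular_arrays n k. \<Prod>i=1..n. fact (k i) / (\<Prod>j=i..n. fact (\<nu> (i, j))) *
        (bernoulli_number ((\<Sum>j=i..n. \<nu> (i, j)) + 1) / of_nat ((\<Sum>j=i..n. \<nu> (i, j)) + 1)))"
proof -
  have prod_0: "(\<Prod>i\<in>A. h i) $ 0 = (\<Prod>i\<in>A. h i $ 0)" for A :: "nat set" and h :: "nat \<Rightarrow> rat fps"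
    by (induction A rule: infinite_finite_induct) auto
  have "(\<Prod>i=1..n. fact (k i)) * (\<Prod>i=1..n. (\<Prod>j=i..n. 1 / fact (\<nu> (i, j))) *
        (fact (\<Sum>j=i..n. \<nu> (i, j)) * xz_regular $ (\<Sum>j=i..n. \<nu> (i, j)))) =
      (-1) ^ (\<Sum>i=1..n. k i) * (\<Prod>i=1..n. fact (k i) / (\<Prod>j=i..n. fact (\<nu> (i, j))) *
        (bernoulli_number ((\<Sum>j=i..n. \<nu> (i, j)) + 1) / of_nat ((\<Sum>j=i..n. \<nu> (i, j)) + 1)))"
    if "\<nu> \<in> triangular_arrays n k" for \<nu>
  proof -
    \<comment> \<open>The row sums and the column sums of \<open>\<nu>\<close> have the same total,
      so the signs of the rows combine to one that is independent of \<open>\<nu>\<close>.\<close>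
    have "(\<Sum>i=1..n. k i) = (\<Sum>i=1..n. \<Sum>j=i..n. \<nu> (i, j))"
      unfolding sum_triangle_swap using that by (intro sum.cong) (auto simp: triangular_arrays_def)
    then have sign: "(-1) ^ (\<Sum>i=1..n. k i) = (\<Prod>i=1..n. (-1 :: rat) ^ (\<Sum>j=i..n. \<nu> (i, j)))"
      by (simp add: power_sum)
    show ?thesis
      unfolding bernoulli_number_Suc sign prod.distrib[symmetric]
      by (intro prod.cong refl) (simp add: xz_regular_def prod_dividef)
  qed
  then show ?thesis
    unfolding zeta_EMS_eq word_act_fps_deriv
    by (simp add: fps_sum_nth prod_0 fps_deriv_maclauren_0 sum_distrib_left
        cong: sum.cong)
qed

section \<open>The generating function\<close>

lemma mcoeff_one: "mcoeff 1 m = (if m = 0 then 1 else 0)"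
  by (rule one_mfps.rep_eq[THEN fun_cong])

lemma mcoeff_mult: "mcoeff (f * g) m = (\<Sum>(a, b) | a + b = m. mcoeff f a * mcoeff g b)"
  by (rule times_mfps.rep_eq[THEN fun_cong])

lemma mcoeff_sum: "mcoeff (\<Sum>i\<in>A. f i) m = (\<Sum>i\<in>A. mcoeff (f i) m)"
  by (induction A rule: infinite_finite_induct) (auto simp: zero_mfps.rep_eq plus_mfps.rep_eq)

lemma mcoeff_prod:
  "finite A \<Longrightarrow> mcoeff (\<Prod>i\<in>A. f i) m = (\<Sum>\<mu>\<in>tuples A m. \<Prod>i\<in>A. mcoeff (f i) (\<mu> i))"
  by (rule prod_tuples[where c = "\<lambda>m f. mcoeff f m"])
    (simp_all add: finite_splittings mcoeff_one mcoeff_mult)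

section \<open>Powers of sums of variables\<close>

lemma mcoeff_var: "mcoeff (mfps_var j) m = (if m = Poly_Mapping.single j 1 then 1 else 0)"
  by (simp add: mfps_var_def Mfps_inverse)

lemma mcoeff_var_mult:
  "mcoeff (mfps_var j * u) (Poly_Mapping.single j 1 + m) = mcoeff u m"
proof -
  have "mcoeff (mfps_var j * u) (Poly_Mapping.single j 1 + m) =
      (\<Sum>(a, b)\<in>{(Poly_Mapping.single j 1, m)}. mcoeff (mfps_var j) a * mcoeff u b)"
    unfolding mcoeff_mult
    by (rule sum.mono_neutral_right) (auto simp: finite_splittings mcoeff_var split: if_splits)
  then show ?thesis by (simp add: mcoeff_var)
qed

lemma mcoeff_var_mult_0:
  assumes "Poly_Mapping.lookup m j = 0"
  shows "mcoeff (mfps_var j * u) m = 0"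
  unfolding mcoeff_mult
  using assms by (intro sum.neutral) (auto simp: mcoeff_var lookup_add)

lemma total_degree_eq:
  "finite J \<Longrightarrow> Poly_Mapping.keys m \<subseteq> J \<Longrightarrow> total_degree m = (\<Sum>j\<in>J. Poly_Mapping.lookup m j)"
  unfolding total_degree_def by (intro sum.mono_neutral_left) (auto simp: in_keys_iff)

lemma total_degree_single_add:
  "total_degree (Poly_Mapping.single j 1 + m) = Suc (total_degree m)"
proof -
  let ?J = "insert j (Poly_Mapping.keys m)"
  have "Poly_Mapping.keys (Poly_Mapping.single j 1 + m) \<subseteq> ?J"
    using Poly_Mapping.keys_add[of "Poly_Mapping.single j 1" m] by auto
  then have "total_degree (Poly_Mapping.single j 1 + m) =
      (\<Sum>i\<in>?J. Poly_Mapping.lookup (Poly_Mapping.single j 1) i + Poly_Mapping.lookup m i)"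
    by (subst total_degree_eq[of ?J]) (auto simp: lookup_add)
  also have "\<dots> = Suc (\<Sum>i\<in>?J. Poly_Mapping.lookup m i)"
    unfolding sum.distrib by (simp add: lookup_single when_def sum.delta)
  also have "(\<Sum>i\<in>?J. Poly_Mapping.lookup m i) = total_degree m"
    by (rule total_degree_eq[symmetric]) auto
  finally show ?thesis .
qed

lemma single_add_cases:
  fixes m :: "nat \<Rightarrow>\<^sub>0 nat"
  assumes "Poly_Mapping.lookup m j \<noteq> 0"
  obtains m' where "m = Poly_Mapping.single j 1 + m'"
proof
  show "m = Poly_Mapping.single j 1 + (m - Poly_Mapping.single j 1)"
    using assms by (intro poly_mapping_eqI) (auto simp: lookup_add lookup_minus lookup_single when_def)
qed

text \<open>The multinomial theorem. Removing the variable \<open>j\<close> lowers its exponent by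
  one and leaves the share \<open>fact k * m_j / ?D\<close>; the exponents \<open>m_j\<close> add up
  to the total degree \<open>Suc k\<close>.\<close>

lemma mcoeff_power_sum_var:
  fixes J :: "nat set"
  assumes "finite J"
  shows "mcoeff ((\<Sum>j\<in>J. mfps_var j :: 'a::field_char_0 mfps) ^ k) m =
    (if Poly_Mapping.keys m \<subseteq> J \<and> total_degree m = k
     then fact k / (\<Prod>j\<in>J. fact (Poly_Mapping.lookup m j)) else 0)"
proof (induction k arbitrary: m)
  case 0
  have "m = 0 \<longleftrightarrow> Poly_Mapping.keys m \<subseteq> J \<and> total_degree m = 0"
    by (auto simp: total_degree_def in_keys_iff intro!: poly_mapping_eqI)
  then show ?case by (auto simp: mcoeff_one)
next
  case (Suc k)
  have step: "mcoeff ((\<Sum>j\<in>J. mfps_var j) ^ Suc k) m =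
      (\<Sum>j\<in>J. mcoeff (mfps_var j * (\<Sum>j\<in>J. mfps_var j :: 'a mfps) ^ k) m)"
    by (simp add: sum_distrib_right mcoeff_sum)
  let ?D = "\<Prod>i\<in>J. fact (Poly_Mapping.lookup m i) :: 'a"
  have "mcoeff (mfps_var j * (\<Sum>j\<in>J. mfps_var j :: 'a mfps) ^ k) m =
      (if Poly_Mapping.keys m \<subseteq> J \<and> total_degree m = Suc k
       then fact k * of_nat (Poly_Mapping.lookup m j) / ?D else 0)"
    if "j \<in> J" for j
  proof (cases "Poly_Mapping.lookup m j = 0")
    case True
    then show ?thesis by (simp add: mcoeff_var_mult_0)
  next
    case False
    then obtain m' where m: "m = Poly_Mapping.single j 1 + m'" by (rule single_add_cases)
    have "Poly_Mapping.keys m = insert j (Poly_Mapping.keys m')"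
      by (auto simp: m in_keys_iff lookup_add lookup_single when_def split: if_splits)
    then have keys: "Poly_Mapping.keys m \<subseteq> J \<longleftrightarrow> Poly_Mapping.keys m' \<subseteq> J" using that by auto
    have D: "?D = of_nat (Poly_Mapping.lookup m j) * (\<Prod>i\<in>J. fact (Poly_Mapping.lookup m' i))"
    proof -
      have "?D = fact (Poly_Mapping.lookup m j) * (\<Prod>i\<in>J - {j}. fact (Poly_Mapping.lookup m i))"
        using assms that by (rule prod.remove)
      also have "(\<Prod>i\<in>J - {j}. fact (Poly_Mapping.lookup m i)) = (\<Prod>i\<in>J - {j}. fact (Poly_Mapping.lookup m' i) :: 'a)"
        by (intro prod.cong) (auto simp: m lookup_add lookup_single)
      also have "fact (Poly_Mapping.lookup m j) = (of_nat (Poly_Mapping.lookup m j) * fact (Poly_Mapping.lookup m' j) :: 'a)"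
        by (simp add: m lookup_add)
      finally show ?thesis
        using prod.remove[OF assms that, of "\<lambda>i. fact (Poly_Mapping.lookup m' i) :: 'a"] by simp
    qed
    have "mcoeff (mfps_var j * (\<Sum>j\<in>J. mfps_var j :: 'a mfps) ^ k) m =
        mcoeff ((\<Sum>j\<in>J. mfps_var j :: 'a mfps) ^ k) m'"
      unfolding m by (rule mcoeff_var_mult)
    also have "\<dots> = (if Poly_Mapping.keys m \<subseteq> J \<and> total_degree m = Suc k
        then fact k / (\<Prod>i\<in>J. fact (Poly_Mapping.lookup m' i)) else 0)"
      unfolding Suc.IH keys by (simp only: m total_degree_single_add nat.inject)
    finally show ?thesis using False by (simp add: D)
  qed
  then have "mcoeff ((\<Sum>j\<in>J. mfps_var j :: 'a mfps) ^ Suc k) m =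
      (\<Sum>j\<in>J. if Poly_Mapping.keys m \<subseteq> J \<and> total_degree m = Suc k
       then fact k * of_nat (Poly_Mapping.lookup m j) / ?D else 0)"
    unfolding step by (rule sum.cong[OF refl])
  also have "\<dots> = (if Poly_Mapping.keys m \<subseteq> J \<and> total_degree m = Suc k
       then fact k * of_nat (total_degree m) / ?D else 0)"
  proof (cases "Poly_Mapping.keys m \<subseteq> J \<and> total_degree m = Suc k")
    case True
    have "(of_nat (total_degree m) :: 'a) = (\<Sum>j\<in>J. of_nat (Poly_Mapping.lookup m j))"
      unfolding total_degree_eq[OF assms conjunct1[OF True]] by (rule of_nat_sum)
    then show ?thesis
      unfolding if_P[OF True] by (simp only: sum_distrib_left sum_divide_distrib)
  next
    case False
    show ?thesis unfolding if_not_P[OF False] by simp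
  qed
  also have "\<dots> = (if Poly_Mapping.keys m \<subseteq> J \<and> total_degree m = Suc k then fact (Suc k) / ?D else 0)"
    by (simp add: mult.commute)
  finally show ?case .
qed

text \<open>A sum of variables is homogeneous of degree 1, so only the power equal to the total
  degree of \<open>m\<close> contributes.\<close>

lemma mcoeff_compose_sum_var:
  fixes F :: "'a::field_char_0 fps"
  assumes "finite J"
  shows "mcoeff (mfps_compose F (\<Sum>j\<in>J. mfps_var j)) m =
    (if Poly_Mapping.keys m \<subseteq> J
     then F $ total_degree m * fact (total_degree m) / (\<Prod>j\<in>J. fact (Poly_Mapping.lookup m j)) else 0)"
  by (simp add: mfps_compose_def Mfps_inverse mcoeff_power_sum_var[OF assms] if_distrib
      sum.delta' cong: if_cong conj_cong)

lemma lookup_sum_single: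
  "finite A \<Longrightarrow> Poly_Mapping.lookup (\<Sum>j\<in>A. Poly_Mapping.single j (h j)) l = (if l \<in> A then h l else 0)"
  by (simp add: lookup_sum lookup_single when_def sum.delta')

section \<open>Expansion of the product and comparison of coefficients\<close>

text \<open>The exponents taken from the \<open>n\<close> factors are the rows of an array; adding
  them up to \<open>m\<close> prescribes the column sums.\<close>

lemma bij_betw_tuples_triangular_arrays:
  assumes "Poly_Mapping.keys m \<subseteq> {1..n}"
  shows "bij_betw (\<lambda>\<mu>. \<lambda>(i, j)\<in>triangle n. Poly_Mapping.lookup (\<mu> i) j)
    {\<mu> \<in> tuples {1..n} m. \<forall>i\<in>{1..n}. Poly_Mapping.keys (\<mu> i) \<subseteq> {i..n}}
    (triangular_arrays n (Poly_Mapping.lookup m))"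
proof (rule bij_betw_byWitness[where f' = "\<lambda>\<nu>. \<lambda>i\<in>{1..n}. \<Sum>j=i..n. Poly_Mapping.single j (\<nu> (i, j))"])
  let ?G = "{\<mu> \<in> tuples {1..n} m. \<forall>i\<in>{1..n}. Poly_Mapping.keys (\<mu> i) \<subseteq> {i..n}}"
  let ?f = "\<lambda>\<mu>. \<lambda>(i, j)\<in>triangle n. Poly_Mapping.lookup (\<mu> i) j"
  let ?g = "\<lambda>\<nu>. \<lambda>i\<in>{1..n}. \<Sum>j=i..n. Poly_Mapping.single j (\<nu> (i, j))"
  have lookup_0: "Poly_Mapping.lookup (\<mu> i) j = 0" if "\<mu> \<in> ?G" "i \<in> {1..n}" "j \<notin> {i..n}" for \<mu> i j
  proof -
    have "Poly_Mapping.keys (\<mu> i) \<subseteq> {i..n}" using that(1,2) by blast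
    with that(3) show ?thesis by (meson in_keys_iff subsetD)
  qed
  show "\<forall>\<mu>\<in>?G. ?g (?f \<mu>) = \<mu>"
  proof
    fix \<mu> assume \<mu>: "\<mu> \<in> ?G"
    show "?g (?f \<mu>) = \<mu>"
    proof
      fix i
      show "?g (?f \<mu>) i = \<mu> i"
      proof (cases "i \<in> {1..n}")
        case True
        then have "Poly_Mapping.lookup (?g (?f \<mu>) i) l = Poly_Mapping.lookup (\<mu> i) l" for l
          using lookup_0[OF \<mu> True, of l] by (auto simp: lookup_sum_single triangle_def)
        then show ?thesis by (rule poly_mapping_eqI)
      qed (use \<mu> in \<open>auto simp: tuples_def PiE_def extensional_def\<close>)
    qed
  qed
  show "\<forall>\<nu>\<in>triangular_arrays n (Poly_Mapping.lookup m). ?f (?g \<nu>) = \<nu>"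
    by (auto simp: fun_eq_iff lookup_sum_single triangle_def triangular_arrays_def PiE_def extensional_def)
  show "?f ` ?G \<subseteq> triangular_arrays n (Poly_Mapping.lookup m)"
  proof clarify
    fix \<mu> assume \<mu>: "\<mu> \<in> tuples {1..n} m" "\<forall>i\<in>{1..n}. Poly_Mapping.keys (\<mu> i) \<subseteq> {i..n}"
    have "(\<Sum>a=1..i. ?f \<mu> (a, i)) = Poly_Mapping.lookup m i" if "i \<in> {1..n}" for i
    proof -
      have "(\<Sum>a=1..i. ?f \<mu> (a, i)) = (\<Sum>a=1..i. Poly_Mapping.lookup (\<mu> a) i)"
        using that by (intro sum.cong) (auto simp: triangle_def)
      \<comment> \<open>Rows with \<open>a > i\<close> are supported in \<open>{a..n}\<close> and
        vanish at \<open>i\<close>.\<close>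
      also have "\<dots> = (\<Sum>a=1..n. Poly_Mapping.lookup (\<mu> a) i)"
        using that \<mu> by (intro sum.mono_neutral_left) (auto intro!: lookup_0)
      also have "\<dots> = Poly_Mapping.lookup m i"
        using \<mu>(1) by (auto simp: tuples_def lookup_sum[symmetric])
      finally show ?thesis .
    qed
    then show "?f \<mu> \<in> triangular_arrays n (Poly_Mapping.lookup m)"
      by (auto simp: triangular_arrays_def)
  qed
  show "?g ` triangular_arrays n (Poly_Mapping.lookup m) \<subseteq> ?G"
  proof clarify
    fix \<nu> assume \<nu>: "\<nu> \<in> triangular_arrays n (Poly_Mapping.lookup m)"
    have "(\<Sum>i=1..n. ?g \<nu> i) = m"
    proof (rule poly_mapping_eqI)
      fix l
      have "Poly_Mapping.lookup (\<Sum>i=1..n. ?g \<nu> i) l = (\<Sum>i=1..n. if l \<in> {i..n} then \<nu> (i, l) else 0)"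
        unfolding lookup_sum by (intro sum.cong refl) (simp add: lookup_sum_single)
      also have "\<dots> = Poly_Mapping.lookup m l"
      proof (cases "l \<in> {1..n}")
        case True
        have "(\<Sum>i=1..n. if l \<in> {i..n} then \<nu> (i, l) else 0) = (\<Sum>i=1..l. \<nu> (i, l))"
          using True by (intro sum.mono_neutral_cong_right) auto
        then show ?thesis using True \<nu> by (auto simp: triangular_arrays_def)
      next
        case False
        \<comment> \<open>Here the support condition on \<open>m\<close> enters: the array has no
          column \<open>l\<close>.\<close>
        then have "Poly_Mapping.lookup m l = 0" using assms by (auto simp: in_keys_iff subset_iff)
        with False show ?thesis by (auto intro!: sum.neutral)
      qed
      finally show "Poly_Mapping.lookup (\<Sum>i=1..n. ?g \<nu> i) l = Poly_Mapping.lookup m l" .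
    qed
    moreover have "Poly_Mapping.keys (\<Sum>j=i..n. Poly_Mapping.single j (\<nu> (i, j))) \<subseteq> {i..n}" for i
      by (auto simp: in_keys_iff lookup_sum_single split: if_splits)
    then have "Poly_Mapping.keys (?g \<nu> i) \<subseteq> {i..n}" if "i \<in> {1..n}" for i
      using that by simp
    moreover have "?g \<nu> \<in> {1..n} \<rightarrow>\<^sub>E UNIV" by (simp only: restrict_PiE_iff UNIV_I ball_triv simp_thms)
    ultimately show "?g \<nu> \<in> tuples {1..n} m \<and> (\<forall>i\<in>{1..n}. Poly_Mapping.keys (?g \<nu> i) \<subseteq> {i..n})"
      unfolding tuples_def by blast
  qed
qed

lemma mcoeff_prod_compose:
  fixes F :: "'a::field_char_0 fps"
  shows "mcoeff (\<Prod>i=1..n. mfps_compose F (\<Sum>j=i..n. mfps_var j)) m =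
    (if Poly_Mapping.keys m \<subseteq> {1..n} then
       \<Sum>\<nu>\<in>triangular_arrays n (Poly_Mapping.lookup m). \<Prod>i=1..n.
         F $ (\<Sum>j=i..n. \<nu> (i, j)) * fact (\<Sum>j=i..n. \<nu> (i, j)) / (\<Prod>j=i..n. fact (\<nu> (i, j)))
     else 0)"
proof -
  let ?c = "\<lambda>i \<mu>. if Poly_Mapping.keys (\<mu> i) \<subseteq> {i..n}
     then F $ total_degree (\<mu> i) * fact (total_degree (\<mu> i)) / (\<Prod>j=i..n. fact (Poly_Mapping.lookup (\<mu> i) j)) else 0"
  let ?G = "{\<mu> \<in> tuples {1..n} m. \<forall>i\<in>{1..n}. Poly_Mapping.keys (\<mu> i) \<subseteq> {i..n}}"
  have "mcoeff (\<Prod>i=1..n. mfps_compose F (\<Sum>j=i..n. mfps_var j)) m =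
      (\<Sum>\<mu>\<in>tuples {1..n} m. \<Prod>i=1..n. ?c i \<mu>)"
    by (simp add: mcoeff_prod mcoeff_compose_sum_var)
  also have "\<dots> = (\<Sum>\<mu>\<in>?G. \<Prod>i=1..n. ?c i \<mu>)"
    \<comment> \<open>A tuple using a variable that does not occur in factor \<open>i\<close> has a
      vanishing \<open>i\<close>-th coefficient.\<close>
    by (rule sum.mono_neutral_right) (auto simp: finite_tuples finite_splittings intro!: prod_zero)
  also have "\<dots> = (if Poly_Mapping.keys m \<subseteq> {1..n} then
       \<Sum>\<nu>\<in>triangular_arrays n (Poly_Mapping.lookup m). \<Prod>i=1..n.
         F $ (\<Sum>j=i..n. \<nu> (i, j)) * fact (\<Sum>j=i..n. \<nu> (i, j)) / (\<Prod>j=i..n. fact (\<nu> (i, j)))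
     else 0)"
  proof (cases "Poly_Mapping.keys m \<subseteq> {1..n}")
    case True
    have "?c i \<mu> = F $ (\<Sum>j=i..n. \<nu> (i, j)) * fact (\<Sum>j=i..n. \<nu> (i, j)) / (\<Prod>j=i..n. fact (\<nu> (i, j)))"
      if "\<mu> \<in> ?G" "i \<in> {1..n}" "\<nu> = (\<lambda>(i, j)\<in>triangle n. Poly_Mapping.lookup (\<mu> i) j)" for \<mu> \<nu> i
    proof -
      have keys: "Poly_Mapping.keys (\<mu> i) \<subseteq> {i..n}" using that by blast
      have *: "Poly_Mapping.lookup (\<mu> i) j = \<nu> (i, j)" if "j \<in> {i..n}" for j
        using that \<open>i \<in> {1..n}\<close> by (auto simp: \<open>\<nu> = _\<close> triangle_def)
      have deg: "total_degree (\<mu> i) = (\<Sum>j=i..n. \<nu> (i, j))"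
        unfolding total_degree_eq[OF finite_atLeastAtMost keys] by (intro sum.cong refl *)
      have "(\<Prod>j=i..n. fact (Poly_Mapping.lookup (\<mu> i) j)) = (\<Prod>j=i..n. fact (\<nu> (i, j)) :: 'a)"
        by (intro prod.cong refl) (simp only: *)
      then show ?thesis by (simp only: keys deg if_True)
    qed
    then have "(\<Sum>\<mu>\<in>?G. \<Prod>i=1..n. ?c i \<mu>) = (\<Sum>\<nu>\<in>triangular_arrays n (Poly_Mapping.lookup m). \<Prod>i=1..n.
         F $ (\<Sum>j=i..n. \<nu> (i, j)) * fact (\<Sum>j=i..n. \<nu> (i, j)) / (\<Prod>j=i..n. fact (\<nu> (i, j))))"
      unfolding sum.reindex_bij_betw[OF bij_betw_tuples_triangular_arrays[OF True], symmetric]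
      by (intro sum.cong prod.cong refl) blast
    with True show ?thesis by simp
  next
    case False
    \<comment> \<open>The support of a sum lies in the union of the supports, so no admissible tuple
      sums to \<open>m\<close>.\<close>
    have "Poly_Mapping.keys m \<subseteq> {1..n}" if "\<mu> \<in> ?G" for \<mu>
    proof -
      have "Poly_Mapping.keys m \<subseteq> (\<Union>i\<in>{1..n}. Poly_Mapping.keys (\<mu> i))"
        using that Poly_Mapping.keys_sum[of \<mu> "{1..n}"] by (auto simp: tuples_def)
      also have "\<dots> \<subseteq> {1..n}" using that by fastforce
      finally show ?thesis .
    qed
    then have "?G = {}" using False by blast
    then show ?thesis unfolding if_not_P[OF False] by (simp only: sum.empty)
  qed
  finally show ?thesis .
qed

theorem corollary3p9:
  fixes n :: nat
  assumes "n \<ge> 1"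
  shows "Z_EMS n = (\<Prod>i=1..n. mfps_compose ems_series (\<Sum>j=i..n. mfps_var j)) \<and>
    (\<forall>k :: nat \<Rightarrow> nat.
       zeta_EMS (map k [1..<Suc n]) =
         (-1) ^ (\<Sum>i=1..n. k i) *
         (\<Sum>\<nu> | \<nu> \<in> {(i, j). 1 \<le> i \<and> i \<le> j \<and> j \<le> n} \<rightarrow>\<^sub>E (UNIV :: nat set) \<and>
               (\<forall>i\<in>{1..n}. (\<Sum>a=1..i. \<nu> (a, i)) = k i).
            \<Prod>i=1..n. fact (k i) / (\<Prod>j=i..n. fact (\<nu> (i, j))) *
              (bernoulli_number ((\<Sum>j=i..n. \<nu> (i, j)) + 1) / of_nat ((\<Sum>j=i..n. \<nu> (i, j)) + 1))))"
proof (intro conjI allI)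
  fix k :: "nat \<Rightarrow> nat"
  show "zeta_EMS (map k [1..<Suc n]) =
         (-1) ^ (\<Sum>i=1..n. k i) *
         (\<Sum>\<nu> | \<nu> \<in> {(i, j). 1 \<le> i \<and> i \<le> j \<and> j \<le> n} \<rightarrow>\<^sub>E (UNIV :: nat set) \<and>
               (\<forall>i\<in>{1..n}. (\<Sum>a=1..i. \<nu> (a, i)) = k i).
            \<Prod>i=1..n. fact (k i) / (\<Prod>j=i..n. fact (\<nu> (i, j))) *
              (bernoulli_number ((\<Sum>j=i..n. \<nu> (i, j)) + 1) / of_nat ((\<Sum>j=i..n. \<nu> (i, j)) + 1)))"
    by (rule zeta_EMS_formula[unfolded triangular_arrays_def triangle_def])
next
  have "mcoeff (Z_EMS n) m = mcoeff (\<Prod>i=1..n. mfps_compose ems_series (\<Sum>j=i..n. mfps_var j)) m" for m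
  proof (cases "Poly_Mapping.keys m \<subseteq> {1..n}")
    case True
    let ?k = "Poly_Mapping.lookup m"
    have of_rat_fact: "of_rat (fact l) = (fact l :: complex)" for l by (metis of_nat_fact of_rat_of_nat_eq)
    \<comment> \<open>The alternating sign and the inverse factorials in \<open>Z_EMS\<close> cancel
      the sign and the factorials \<open>k_i!\<close> in the formula for the values.\<close>
    have sign: "(\<Prod>i=1..n. (-1) ^ ?k i / fact (?k i)) * ((-1) ^ (\<Sum>i=1..n. ?k i) * (\<Prod>i=1..n. fact (?k i) * x i)) =
        (\<Prod>i=1..n. x i :: complex)" for x
      unfolding power_sum prod.distrib[symmetric] by (intro prod.cong refl) (simp flip: power_mult_distrib)
    have summand: "of_rat (\<Prod>i=1..n. fact (?k i) / (\<Prod>j=i..n. fact (\<nu> (i, j))) *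
          (fact (\<Sum>j=i..n. \<nu> (i, j)) * bernoulli_fps $ Suc (\<Sum>j=i..n. \<nu> (i, j)))) =
        (\<Prod>i=1..n. fact (?k i) * (ems_series $ (\<Sum>j=i..n. \<nu> (i, j)) * fact (\<Sum>j=i..n. \<nu> (i, j)) /
          (\<Prod>j=i..n. fact (\<nu> (i, j)))))" for \<nu>
      by (simp add: of_rat_prod of_rat_mult of_rat_divide of_rat_fact ems_series_nth mult_ac)
    have "mcoeff (Z_EMS n) m = (\<Prod>i=1..n. (-1) ^ ?k i / fact (?k i)) * of_rat (zeta_EMS (map ?k [1..<Suc n]))"
      using True by (simp add: Z_EMS_def Mfps_inverse)
    also have "\<dots> = (\<Sum>\<nu>\<in>triangular_arrays n ?k. \<Prod>i=1..n.
         ems_series $ (\<Sum>j=i..n. \<nu> (i, j)) * fact (\<Sum>j=i..n. \<nu> (i, j)) / (\<Prod>j=i..n. fact (\<nu> (i, j))))"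
      unfolding zeta_EMS_formula bernoulli_number_Suc of_rat_mult of_rat_sum summand
      by (simp only: of_rat_power of_rat_minus of_rat_1 sum_distrib_left sign)
    finally show ?thesis unfolding mcoeff_prod_compose if_P[OF True] .
  next
    \<comment> \<open>Both sides involve only the variables \<open>1\<close> to \<open>n\<close>, so
      both coefficients are 0.\<close>
    case False
    then show ?thesis unfolding mcoeff_prod_compose if_not_P[OF False] by (simp add: Z_EMS_def Mfps_inverse)
  qed
  then show "Z_EMS n = (\<Prod>i=1..n. mfps_compose ems_series (\<Sum>j=i..n. mfps_var j))"
    by (metis mcoeff_inject ext)
qed

end
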